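(* Let $q=(q_{ij})\in\mathbb{R}^{r\times r}$, $\bar e=(\bar e_{ij})$, $\bar f=(\bar f_{ij})$, $\bar a=(\bar a_i)$ satisfy all of the following constraints (i.e. be a feasible solution of the fluid-based optimization problem): $$\lambda_iP_{ij}\bar a_i=\mu_{ij}\bar f_{ij}\ (1\le i,j\le r),\qquad \mu_{ij}\bar e_{ij}=q_{ij}\sum_{k=1}^r\mu_{ki}\bar f_{ki}\ (1\le i\ne j\le r),$$ $$\lambda_i\bar a_i=\sum_{k\ne i}\mu_{ki}\bar e_{ki}+q_{ii}\sum_{k=1}^r\mu_{ki}\bar f_{ki}\ (1\le i\le r),\qquad (1-\bar a_i)\bar e_{ii}=0\ (1\le i\le r),$$ $$(\bar e,\bar f)\in\mathcal{T},\qquad q_{ij}\ge 0,\quad \sum_{j=1}^r q_{ij}=1,\quad 0\le\bar a_i\le 1\ (1\le i,j\le r).$$ Use the static routing policy $Q=q$. Assume $P_{ij}>0$ for all $1\le i,j\le r$ and $q_{ii}>0$ for all $1\le i\le r$. Then, as $N\to\infty$, $$\bar F^{(N)}(\infty)\Rightarrow\bar f,\qquad \bar E^{(N)}_{ij}(\infty)\Rightarrow\bar e_{ij}\ (1\le i\ne j\le r),$$ $$\bar E^{(N)}_{ii}(\infty)\Rightarrow 0\ \text{ for every } i \text{ with } \bar a_i<1,\qquad \sum_{i:\bar a_i=1}\bar E^{(N)}_{ii}(\infty)\Rightarrow\sum_{i:\bar a_i=1}\bar e_{ii},$$ and $$\mathbb{P}\big(E^{(N)}_{ii}(\infty)>0\big)\to\bar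 a_i,\qquad 1\le i\le r.$$
   Context: Fix an integer $r\ge1$ (number of regions), reals $\lambda_i>0$, $\mu_{ij}>0$ ($1\le i,j\le r$), and an $r\times r$ row-stochastic matrix $P=(P_{ij})$. Let $$\mathcal{T}=\Big\{(e,f)\in[0,1]^{r\times r}\times[0,1]^{r\times r}:\ \sum_{i=1}^r\sum_{j=1}^r(e_{ij}+f_{ij})=1\Big\}.$$ A static routing policy is an $r\times r$ row-stochastic matrix $Q=(Q_{ij})$. For each positive integer $N$ (number of cars), $(E^{(N)},F^{(N)})$ is the continuous-time Markov chain on the finite set of pairs $(E,F)\in\mathbb{Z}_+^{r\times r}\times\mathbb{Z}_+^{r\times r}$ with $\sum_{i,j}(E_{ij}+F_{ij})=N$ and the following transitions: (i) for all $i,j$: at rate $N\lambda_iP_{ij}1(E_{ii}>0)$, $E_{ii}$ decreases by 1 and $F_{ij}$ increases by 1; (ii) for all $i,j,k$: at rate $\mu_{ij}F_{ij}Q_{jk}$, $F_{ij}$ decreases by 1 and $E_{jk}$ increases by 1; (iii) for all $i\ne j$: at rate $\mu_{ij}E_{ij}$, $E_{ij}$ decreases by 1 and $E_{jj}$ increases by 1. Here $E_{ii}$ is the number of empty cars waiting in region $i$, $E_{ij}$ ($i\neq j$) the number of empty cars travelling from $i$ to $j$, and $F_{ij}$ the number of full cars travelling from $i$ to $j$. The chain is assumed to have a single recurrent class; $(E^{(N)}(\infty),F^{(N)}(\infty))$ denotes a random element with its stationary distribution, and $\bar E^{(N)}(\infty)=E^{(N)}(\infty)/N$, $\bar F^{(N)}(\infty)=F^{(N)}(\infty)/N$.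 The symbol $\Rightarrow$ denotes weak convergence (convergence in distribution). *)

theory Defs
  imports "HOL-Probability.Probability"
begin

section \<open>Finite-state continuous-time Markov chains\<close>

text \<open>A chain is given by a finite state space \<open>S\<close> and jump rates \<open>q x y\<close> for \<open>x \<noteq> y\<close>; the
  diagonal of \<open>q\<close> is ignored. Its transition function is \<open>P\<^sub>t = exp (t G)\<close> for the generator \<open>G\<close>,
  as a power series in \<open>t\<close> (convergent since \<open>S\<close> is finite).\<close>

definition generator :: "'s set \<Rightarrow> ('s \<Rightarrow> 's \<Rightarrow> real) \<Rightarrow> 's \<Rightarrow> 's \<Rightarrow> real" where
  "generator S q x y = (if x = y then - (\<Sum>z\<in>S - {x}. q x z) else q x y)"

primrec generator_power ::
    "'s set \<Rightarrow> ('s \<Rightarrow> 's \<Rightarrow> real) \<Rightarrow> nat \<Rightarrow> 's \<Rightarrow> 's \<Rightarrow> real" where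
  "generator_power S q 0 x y = (if x = y then 1 else 0)"
| "generator_power S q (Suc n) x y =
     (\<Sum>z\<in>S. generator S q x z * generator_power S q n z y)"

definition transition_function ::
    "'s set \<Rightarrow> ('s \<Rightarrow> 's \<Rightarrow> real) \<Rightarrow> real \<Rightarrow> 's \<Rightarrow> 's \<Rightarrow> real" where
  "transition_function S q t x y = (\<Sum>n. t ^ n / fact n * generator_power S q n x y)"

definition stationary_distribution ::
    "'s set \<Rightarrow> ('s \<Rightarrow> 's \<Rightarrow> real) \<Rightarrow> 's pmf \<Rightarrow> bool" where
  "stationary_distribution S q \<pi> \<longleftrightarrow>
     set_pmf \<pi> \<subseteq> S \<and>
     (\<forall>t\<ge>0. \<forall>y\<in>S. (\<Sum>x\<in>S. pmf \<pi> x * transition_function S q t x y) = pmf \<pi> y)"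

definition reachable :: "'s set \<Rightarrow> ('s \<Rightarrow> 's \<Rightarrow> real) \<Rightarrow> 's \<Rightarrow> 's \<Rightarrow> bool" where
  "reachable S q = (\<lambda>x y. x \<in> S \<and> y \<in> S \<and> x \<noteq> y \<and> q x y > 0)\<^sup>*\<^sup>*"

text \<open>For a finite chain the recurrent classes are the closed communicating classes, i.e. the
  nonempty sets from each of whose states exactly the set itself can be reached.\<close>

definition recurrent_class :: "'s set \<Rightarrow> ('s \<Rightarrow> 's \<Rightarrow> real) \<Rightarrow> 's set \<Rightarrow> bool" where
  "recurrent_class S q C \<longleftrightarrow>
     C \<noteq> {} \<and> C \<subseteq> S \<and> (\<forall>x\<in>C. {y \<in> S. reachable S q x y} = C)"

section \<open>Weak convergence\<close>

text \<open>The library's \<open>weak_conv_m\<close> only covers measures on the real line; the lemma below shows that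
  the following notion agrees with it there.\<close>

definition weakly_converges ::
    "(nat \<Rightarrow> 'a::topological_space measure) \<Rightarrow> 'a measure \<Rightarrow> bool" where
  "weakly_converges M_seq M \<longleftrightarrow>
     (\<forall>g :: 'a \<Rightarrow> real. continuous_on UNIV g \<and> bounded (range g) \<longrightarrow>
        (\<lambda>n. \<integral>x. g x \<partial>M_seq n) \<longlonglongrightarrow> (\<integral>x. g x \<partial>M))"

lemma weakly_converges_iff_weak_conv_m:
  assumes "\<And>n. real_distribution (M_seq n)" and "real_distribution M"
  shows "weakly_converges M_seq M \<longleftrightarrow> weak_conv_m M_seq M"
proof
  assume w: "weakly_converges M_seq M"
  show "weak_conv_m M_seq M"
  proof (rule integral_bdd_continuous_conv_imp_weak_conv[OF assms])
    fix g :: "real \<Rightarrow> real"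
    assume "\<And>x. isCont g x" and "\<And>x. \<bar>g x\<bar> \<le> 1"
    then have "continuous_on UNIV g" and "bounded (range g)"
      by (auto simp: continuous_at_imp_continuous_on bounded_iff)
    with w show "(\<lambda>n. integral\<^sup>L (M_seq n) g) \<longlonglongrightarrow> integral\<^sup>L M g"
      unfolding weakly_converges_def by blast
  qed
next
  assume w: "weak_conv_m M_seq M"
  show "weakly_converges M_seq M"
    unfolding weakly_converges_def
  proof (intro allI impI)
    fix g :: "real \<Rightarrow> real"
    assume g: "continuous_on UNIV g \<and> bounded (range g)"
    then obtain B where "\<And>x. norm (g x) \<le> B"
      by (auto simp: bounded_iff)
    moreover have "isCont g x" for x
      using g by (simp add: continuous_on_eq_continuous_at)
    ultimately show "(\<lambda>n. \<integral>x. g x \<partial>M_seq n) \<longlonglongrightarrow> (\<integral>x. g x \<partial>M)"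
      using weak_conv_imp_integral_bdd_continuous_conv[OF assms w] by blast
  qed
qed

definition law :: "'s pmf \<Rightarrow> ('s \<Rightarrow> 'a::topological_space) \<Rightarrow> 'a measure" where
  "law \<pi> X = distr (measure_pmf \<pi>) borel X"

definition converges_in_law_to_const ::
    "(nat \<Rightarrow> 's pmf) \<Rightarrow> (nat \<Rightarrow> 's \<Rightarrow> 'a::topological_space) \<Rightarrow> 'a \<Rightarrow> bool" where
  "converges_in_law_to_const \<pi> X c \<longleftrightarrow>
     weakly_converges (\<lambda>N. law (\<pi> N) (X N)) (return borel c)"

section \<open>The car-sharing network\<close>

text \<open>The regions are the elements of the finite type \<open>'r\<close>. A state is a pair \<open>(E, F)\<close> of
  matrices of car counts.\<close>

type_synonym 'r state = "(nat ^ 'r ^ 'r) \<times> (nat ^ 'r ^ 'r)"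

definition row_stochastic :: "real ^ 'r ^ 'r \<Rightarrow> bool" where
  "row_stochastic P \<longleftrightarrow> (\<forall>i j. 0 \<le> P $ i $ j) \<and> (\<forall>i. (\<Sum>j\<in>UNIV. P $ i $ j) = 1)"

definition unit_matrix :: "'r \<Rightarrow> 'r \<Rightarrow> nat ^ 'r ^ 'r" where
  "unit_matrix i j = (\<chi> k l. if k = i \<and> l = j then 1 else 0)"

definition car_states :: "nat \<Rightarrow> 'r::finite state set" where
  "car_states N = {(E, F). (\<Sum>i\<in>UNIV. \<Sum>j\<in>UNIV. E $ i $ j + F $ i $ j) = N}"

text \<open>Subtraction of natural numbers is truncated, but each transition has rate 0 whenever the
  entry it would decrease is 0.\<close>

definition car_rate ::
    "nat \<Rightarrow> real ^ 'r \<Rightarrow> real ^ 'r ^ 'r \<Rightarrow> real ^ 'r ^ 'r \<Rightarrow> real ^ 'r ^ 'r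
      \<Rightarrow> 'r::finite state \<Rightarrow> 'r state \<Rightarrow> real" where
  "car_rate N \<Lambda> \<mu> P Q = (\<lambda>(E, F) y.
     (\<Sum>i\<in>UNIV. \<Sum>j\<in>UNIV.
        if y = (E - unit_matrix i i, F + unit_matrix i j)
        then real N * \<Lambda> $ i * P $ i $ j * (if E $ i $ i > 0 then 1 else 0) else 0)
   + (\<Sum>i\<in>UNIV. \<Sum>j\<in>UNIV. \<Sum>k\<in>UNIV.
        if y = (E + unit_matrix j k, F - unit_matrix i j)
        then \<mu> $ i $ j * real (F $ i $ j) * Q $ j $ k else 0)
   + (\<Sum>i\<in>UNIV. \<Sum>j\<in>UNIV - {i}.
        if y = (E - unit_matrix i j + unit_matrix j j, F)
        then \<mu> $ i $ j * real (E $ i $ j) else 0))"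

definition scaled :: "nat \<Rightarrow> nat ^ 'r ^ 'r \<Rightarrow> real ^ 'r ^ 'r" where
  "scaled N A = (\<chi> i j. real (A $ i $ j) / real N)"

section \<open>The fluid-based optimization problem\<close>

definition fluid_simplex :: "((real ^ 'r ^ 'r) \<times> (real ^ 'r ^ 'r)) set" where
  "fluid_simplex = {(e, f).
     (\<forall>i j. e $ i $ j \<in> {0..1}) \<and> (\<forall>i j. f $ i $ j \<in> {0..1}) \<and>
     (\<Sum>i\<in>UNIV. \<Sum>j\<in>UNIV. e $ i $ j + f $ i $ j) = 1}"

definition fluid_feasible ::
    "real ^ 'r \<Rightarrow> real ^ 'r ^ 'r \<Rightarrow> real ^ 'r ^ 'r
      \<Rightarrow> real ^ 'r ^ 'r \<Rightarrow> real ^ 'r ^ 'r \<Rightarrow> real ^ 'r ^ 'r \<Rightarrow> real ^ 'r \<Rightarrow> bool" where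
  "fluid_feasible \<Lambda> \<mu> P q e f a \<longleftrightarrow>
     (\<forall>i j. \<Lambda> $ i * P $ i $ j * a $ i = \<mu> $ i $ j * f $ i $ j) \<and>
     (\<forall>i j. i \<noteq> j \<longrightarrow>
        \<mu> $ i $ j * e $ i $ j = q $ i $ j * (\<Sum>k\<in>UNIV. \<mu> $ k $ i * f $ k $ i)) \<and>
     (\<forall>i. \<Lambda> $ i * a $ i =
        (\<Sum>k\<in>UNIV - {i}. \<mu> $ k $ i * e $ k $ i)
        + q $ i $ i * (\<Sum>k\<in>UNIV. \<mu> $ k $ i * f $ k $ i)) \<and>
     (\<forall>i. (1 - a $ i) * e $ i $ i = 0) \<and>
     (e, f) \<in> fluid_simplex \<and>
     row_stochastic q \<and>
     (\<forall>i. 0 \<le> a $ i \<and> a $ i \<le> 1)"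

end

(* The network is a closed queueing network whose traffic equations are solved by the fluid solution,
so its invariant measure has product form: the weight of (E, F) is the product of a_i^E_ii over i, of
(N e_ij)^E_ij / E_ij! over i \<noteq> j and of (N f_ij)^F_ij / F_ij! over i, j. As there is only one
recurrent class, the stationary distribution is this measure normalised. By complementary slackness
a_i^n \<ge> exp (- N e_ii) (N e_ii)^n / n!, so the multinomial theorem bounds the normalising sum from
below by exp (- N sum_i e_ii) N^N / N!. A Chernoff bound for each single weight makes the states in
which some coordinate is off by \<epsilon> N exponentially negligible against it, and there are only
polynomially many states. A queue with a_i = 1 has no concentration of its own, but the total number
of cars fixes the sum over such queues. Finally P (E_ii > 0) is determined by the throughput identity
\<lambda>_i P_ii P (E_ii > 0) = \<mu>_ii E [F_ii / N]. *)

theory Submission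
  imports Defs
begin

section \<open>Invariant measures of finite Markov chains\<close>

text \<open>The estimates succeed because upper and lower bounds meet on the exponential scale. By
  Stirling the lower bound on the normalising sum is \<open>exp (N * rigid_mass)\<close> up to a
  factor polynomial in N, and the same exponential bounds the weight of every single state. No
  variational problem has to be solved: any exponential saving at one station makes a state
  negligible. This match rests on the normalisation of the loads. The traffic equations leave a
  common factor free, and the fluid solution fixes it so that the means add up to exactly N. The
  Poisson terms of mean N e_ii at a queue are only a device for the lower bound. The true weights of
  a queue with a_i = 1 are constant, so nothing determines how the waiting cars are split among such
  queues, and only their sum can converge. The event E_ii > 0 needs an argument of its own: it is
  not a continuous function of the scaled state, since a queue may be nonempty and still vanish on
  the fluid scale.\<close>

lemma generator_power_bound:
  assumes "finite S"
  obtains K where "\<And>n x y. x \<in> S \<Longrightarrow> y \<in> S \<Longrightarrow> \<bar>generator_power S q n x y\<bar> \<le> K ^ n"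
proof
  \<comment> \<open>The sum of all absolute entries dominates every row sum. Any geometric bound
    serves, since it only has to make the exponential series converge for every t.\<close>
  define K where "K = (\<Sum>x\<in>S. \<Sum>z\<in>S. \<bar>generator S q x z\<bar>)"
  have K0: "0 \<le> K" unfolding K_def by (intro sum_nonneg) auto
  have row: "(\<Sum>z\<in>S. \<bar>generator S q x z\<bar>) \<le> K" if "x \<in> S" for x
    unfolding K_def
    by (rule member_le_sum[OF that, of "\<lambda>x. \<Sum>z\<in>S. \<bar>generator S q x z\<bar>"])
       (use assms in \<open>auto intro: sum_nonneg\<close>)
  fix n x y assume "x \<in> S" "y \<in> S"
  then show "\<bar>generator_power S q n x y\<bar> \<le> K ^ n"
  proof (induction n arbitrary: x)
    case (Suc n)
    have "\<bar>generator_power S q (Suc n) x y\<bar>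
        \<le> (\<Sum>z\<in>S. \<bar>generator S q x z * generator_power S q n z y\<bar>)"
      by (simp add: sum_abs)
    also have "\<dots> \<le> (\<Sum>z\<in>S. \<bar>generator S q x z\<bar> * K ^ n)"
      using Suc by (intro sum_mono) (auto simp: abs_mult intro!: mult_left_mono)
    also have "\<dots> \<le> K * K ^ n"
      using row[of x] Suc K0 by (simp flip: sum_distrib_right add: mult_right_mono)
    finally show ?case by simp
  qed auto
qed

text \<open>Constancy is given for positive times only, so the derivative is known to vanish to the
  right of 0. Its value at 0, which is the linear coefficient, then follows by continuity.\<close>

lemma powser_const_imp_coeff1_eq_0:
  fixes c :: "nat \<Rightarrow> real"
  assumes summ: "\<And>t. summable (\<lambda>n. c n * t ^ n)"
    and const: "\<And>t. t > 0 \<Longrightarrow> (\<Sum>n. c n * t ^ n) = v"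
  shows "c 1 = 0"
proof -
  have zero: "(\<Sum>n. diffs c n * t ^ n) = 0" if "t > 0" for t
  proof -
    have "((\<lambda>t. \<Sum>n. c n * t ^ n) has_real_derivative (\<Sum>n. diffs c n * t ^ n)) (at t)"
      by (rule termdiffs_strong_converges_everywhere[OF summ])
    moreover have "((\<lambda>t. \<Sum>n. c n * t ^ n) has_real_derivative 0) (at t)"
    proof (rule DERIV_cong_ev[THEN iffD2, OF refl _ refl])
      show "((\<lambda>t. v) has_real_derivative 0) (at t)" by simp
      show "\<forall>\<^sub>F t in nhds t. (\<Sum>n. c n * t ^ n) = v"
        using eventually_nhds_in_open[of "{0<..}" t] that
        by (auto elim!: eventually_mono simp: const)
    qed
    ultimately show ?thesis by (rule DERIV_unique)
  qed
  have "isCont (\<lambda>t. \<Sum>n. diffs c n * t ^ n) 0"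
    by (rule isCont_powser_converges_everywhere)
       (rule termdiff_converges_all[OF summ])
  then have "((\<lambda>t. \<Sum>n. diffs c n * t ^ n) \<longlongrightarrow> diffs c 0) (at_right 0)"
    by (auto simp: isCont_def intro: filterlim_at_split[THEN iffD1, THEN conjunct2])
  moreover have "((\<lambda>t. \<Sum>n. diffs c n * t ^ n) \<longlongrightarrow> 0) (at_right 0)"
    by (rule tendsto_eventually) (auto simp: eventually_at_right_less zero eventually_at_topological)
  ultimately have "diffs c 0 = 0"
    by (rule tendsto_unique[OF trivial_limit_at_right_real])
  then show ?thesis by (simp add: diffs_def)
qed

text \<open>Invariance under \<open>transition_function\<close> at all times is an identity of power
  series in t; its linear coefficient is the generator equation.\<close>

lemma stationary_distribution_generator:
  assumes fin: "finite S" and stat: "stationary_distribution S q \<pi>" and y: "y \<in> S"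
  shows "(\<Sum>x\<in>S. pmf \<pi> x * generator S q x y) = 0"
proof -
  obtain K where K: "\<And>n x y. x \<in> S \<Longrightarrow> y \<in> S \<Longrightarrow> \<bar>generator_power S q n x y\<bar> \<le> K ^ n"
    using generator_power_bound[OF fin] by metis
  define c where "c n = (\<Sum>x\<in>S. pmf \<pi> x * (generator_power S q n x y / fact n))" for n
  have sx: "summable (\<lambda>n. t ^ n / fact n * generator_power S q n x y)" if "x \<in> S" for x t
  proof (rule summable_comparison_test')
    show "summable (\<lambda>n. (\<bar>t\<bar> * K) ^ n /\<^sub>R fact n)" by (rule summable_exp_generic)
    show "norm (t ^ n / fact n * generator_power S q n x y) \<le> (\<bar>t\<bar> * K) ^ n /\<^sub>R fact n" for n
      using mult_left_mono[OF K[OF that y], of "\<bar>t\<bar> ^ n / fact n" n]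
      by (simp add: abs_mult power_abs power_mult_distrib field_simps)
  qed
  have c_eq: "(\<lambda>n. c n * t ^ n)
      = (\<lambda>n. \<Sum>x\<in>S. pmf \<pi> x * (t ^ n / fact n * generator_power S q n x y))" for t
    by (simp add: c_def sum_distrib_right sum_distrib_left fun_eq_iff field_simps)
  have "c 1 = 0"
  proof (rule powser_const_imp_coeff1_eq_0)
    show "summable (\<lambda>n. c n * t ^ n)" for t
      unfolding c_eq by (intro summable_sum summable_mult sx)
    show "(\<Sum>n. c n * t ^ n) = pmf \<pi> y" if "t > 0" for t
    proof -
      have "(\<Sum>n. c n * t ^ n) = (\<Sum>x\<in>S. \<Sum>n. pmf \<pi> x * (t ^ n / fact n * generator_power S q n x y))"
        unfolding c_eq by (intro suminf_sum summable_mult sx)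
      also have "\<dots> = (\<Sum>x\<in>S. pmf \<pi> x * transition_function S q t x y)"
        unfolding transition_function_def by (intro sum.cong refl suminf_mult sx)
      also have "\<dots> = pmf \<pi> y"
        using stat that y unfolding stationary_distribution_def by auto
      finally show ?thesis .
    qed
  qed
  moreover have "generator_power S q 1 x y = generator S q x y" for x
    using fin y by (simp add: sum.delta if_distrib cong: if_cong)
  ultimately show ?thesis by (simp add: c_def)
qed

section \<open>Balance equations tested against functions\<close>

lemma sum_generator:
  assumes "finite S" "x \<in> S"
  shows "(\<Sum>y\<in>S. generator S q x y * h y) = (\<Sum>y\<in>S. q x y * (h y - h x))"
proof -
  have "(\<Sum>y\<in>S. generator S q x y * h y)
      = generator S q x x * h x + (\<Sum>y\<in>S-{x}. generator S q x y * h y)"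
    using assms by (simp add: sum.remove)
  also have "(\<Sum>y\<in>S-{x}. generator S q x y * h y) = (\<Sum>y\<in>S-{x}. q x y * h y)"
    by (intro sum.cong) (auto simp: generator_def)
  also have "generator S q x x * h x + (\<Sum>y\<in>S-{x}. q x y * h y) = (\<Sum>y\<in>S-{x}. q x y * (h y - h x))"
    by (simp add: generator_def sum_distrib_right right_diff_distrib sum_subtractf)
  also have "\<dots> = (\<Sum>y\<in>S. q x y * (h y - h x))"
    using assms by (simp add: sum.remove)
  finally show ?thesis .
qed

text \<open>The weak form of the statement that \<open>d\<close> times the generator is 0. A
  transition enters only through the increment of \<open>h\<close>, which suits rates that are sums
  over moves. No sign of \<open>d\<close> is required, so differences of measures qualify.\<close>

definition balanced :: "'s set \<Rightarrow> ('s \<Rightarrow> 's \<Rightarrow> real) \<Rightarrow> ('s \<Rightarrow> real) \<Rightarrow> bool" where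
  "balanced S q d \<longleftrightarrow> (\<forall>h. (\<Sum>x\<in>S. d x * (\<Sum>y\<in>S. q x y * (h y - h x))) = 0)"

lemma balanced_diff:
  assumes "balanced S q d" "balanced S q d'"
  shows "balanced S q (\<lambda>x. d x - c * d' x)"
  using assms unfolding balanced_def
  by (simp add: left_diff_distrib sum_subtractf mult.assoc flip: sum_distrib_left)

lemma balanced_uminus: "balanced S q d \<Longrightarrow> balanced S q (\<lambda>x. - d x)"
  by (simp add: balanced_def sum_negf)

lemma stationary_distribution_balanced:
  assumes fin: "finite S" and stat: "stationary_distribution S q \<pi>"
  shows "balanced S q (pmf \<pi>)"
  unfolding balanced_def
proof
  fix h
  have "(\<Sum>x\<in>S. pmf \<pi> x * (\<Sum>y\<in>S. q x y * (h y - h x)))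
      = (\<Sum>x\<in>S. pmf \<pi> x * (\<Sum>y\<in>S. generator S q x y * h y))"
    using fin by (intro sum.cong refl) (simp add: sum_generator)
  also have "\<dots> = (\<Sum>y\<in>S. (\<Sum>x\<in>S. pmf \<pi> x * generator S q x y) * h y)"
    unfolding sum_distrib_left sum_distrib_right
    by (subst sum.swap) (simp add: mult.assoc)
  also have "\<dots> = 0"
    using stationary_distribution_generator[OF fin stat] by simp
  finally show "(\<Sum>x\<in>S. pmf \<pi> x * (\<Sum>y\<in>S. q x y * (h y - h x))) = 0" .
qed

section \<open>Closed sets and uniqueness of the invariant measure\<close>

lemma closed_set_contains_recurrent_class:
  assumes "finite S" "A \<subseteq> S" "A \<noteq> {}"
    and closed: "\<And>x y. x \<in> A \<Longrightarrow> y \<in> S \<Longrightarrow> q x y > 0 \<Longrightarrow> y \<in> A"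
  obtains C where "recurrent_class S q C" "C \<subseteq> A"
proof -
  define R where "R x = {y \<in> S. reachable S q x y}" for x
  have RA: "R x \<subseteq> A" if "x \<in> A" for x
  proof -
    have "y \<in> A" if "reachable S q x y" for y
      using that unfolding reachable_def
      by (induction rule: rtranclp_induct) (use \<open>x \<in> A\<close> closed in auto)
    then show ?thesis by (auto simp: R_def)
  qed
  \<comment> \<open>Minimality is the point: a state reachable from \<open>x\<close> reaches no more
    than \<open>x\<close> does, and by the choice of \<open>x\<close> no less, so all these states
    have the same reachable set.\<close>
  obtain x where x: "x \<in> A" and min: "\<And>y. y \<in> A \<Longrightarrow> card (R x) \<le> card (R y)"
    using \<open>A \<noteq> {}\<close> ex_has_least_nat[of "\<lambda>x. x \<in> A" _ "\<lambda>x. card (R x)"] by blast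
  have finR: "finite (R y)" for y using \<open>finite S\<close> by (simp add: R_def)
  have "R y = R x" if "y \<in> R x" for y
  proof (rule card_seteq)
    show "R y \<subseteq> R x"
      using that by (auto simp: R_def reachable_def)
    show "card (R x) \<le> card (R y)"
      using min RA[OF x] that by blast
  qed (rule finR)
  moreover have "x \<in> R x"
    using x assms(2) by (auto simp: R_def reachable_def)
  moreover have "R x \<subseteq> S"
    by (auto simp: R_def)
  ultimately have "recurrent_class S q (R x)"
    unfolding recurrent_class_def R_def[symmetric] by blast
  then show thesis using RA[OF x] by (rule that)
qed

text \<open>Test with the indicator \<open>h\<close> of the set where \<open>d\<close> is not
  positive. States with d > 0 can only raise \<open>h\<close> and the others can only lower it, so
  every term of the balance is nonnegative. All terms therefore vanish, and no jump leads out of the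
  positive part.\<close>

lemma balanced_positive_part_closed:
  assumes fin: "finite S" and q: "\<And>x y. 0 \<le> q x y" and d: "balanced S q d"
    and x: "x \<in> S" "d x > 0" and y: "y \<in> S" "q x y > 0"
  shows "d y > 0"
proof (rule ccontr)
  assume dy: "\<not> d y > 0"
  define h where "h z = (if d z > 0 then 0 else 1::real)" for z
  define T where "T z = d z * (\<Sum>z'\<in>S. q z z' * (h z' - h z))" for z
  have T0: "0 \<le> T z" if "z \<in> S" for z
  proof (cases "d z > 0")
    case True
    then show ?thesis
      unfolding T_def using q by (intro mult_nonneg_nonneg sum_nonneg) (auto simp: h_def)
  next
    case False
    then show ?thesis
      unfolding T_def using q by (intro mult_nonpos_nonpos sum_nonpos) (auto simp: h_def mult_le_0_iff)
  qed
  have "(\<Sum>z\<in>S. T z) = 0"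
    using d unfolding balanced_def T_def by blast
  then have "T x = 0"
    using T0 x fin by (simp add: sum_nonneg_eq_0_iff)
  then have "(\<Sum>z'\<in>S. q x z' * (h z' - h x)) = 0"
    using x by (simp add: T_def)
  moreover have "0 \<le> q x z' * (h z' - h x)" for z'
    using q x by (simp add: h_def)
  ultimately have "q x y * (h y - h x) = 0"
    using fin y sum_nonneg_eq_0_iff[OF fin, of "\<lambda>z'. q x z' * (h z' - h x)"] by blast
  then show False
    using x y dy by (simp add: h_def)
qed

text \<open>The sets where \<open>d > 0\<close> and where \<open>d < 0\<close> are both closed, so if neither were empty there
  would be two recurrent classes.\<close>

lemma balanced_sum_zero_imp_zero:
  assumes fin: "finite S" and q: "\<And>x y. 0 \<le> q x y" and d: "balanced S q d"
    and sum0: "(\<Sum>x\<in>S. d x) = 0"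
    and unique: "\<exists>!C. recurrent_class S q C" and x: "x \<in> S"
  shows "d x = 0"
proof -
  have pos: "\<exists>y\<in>S. g y > 0" if g: "(\<Sum>x\<in>S. g x) = 0" "g x \<noteq> 0" for g :: "_ \<Rightarrow> real"
  proof (rule ccontr)
    assume "\<not> (\<exists>y\<in>S. g y > 0)"
    then have "\<And>y. y \<in> S \<Longrightarrow> 0 \<le> - g y" by force
    then have "\<forall>y\<in>S. - g y = 0"
      using fin g sum_nonneg_eq_0_iff[of S "\<lambda>y. - g y"] by (simp add: sum_negf)
    then show False using x g by simp
  qed
  have has_class: "\<exists>C. recurrent_class S q C \<and> C \<subseteq> {y \<in> S. g y > 0}"
    if "balanced S q g" "\<exists>y\<in>S. g y > 0" for g
  proof -
    have "\<exists>C. recurrent_class S q C \<and> C \<subseteq> {y \<in> S. g y > 0}"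
      if "{y \<in> S. g y > 0} \<noteq> {}"
    proof (rule closed_set_contains_recurrent_class[OF fin _ that])
      show "y \<in> {y \<in> S. g y > 0}" if "x \<in> {y \<in> S. g y > 0}" "y \<in> S" "q x y > 0" for x y
        using balanced_positive_part_closed[OF fin q \<open>balanced S q g\<close>] that by blast
    qed auto
    then show ?thesis using that(2) by auto
  qed
  show ?thesis
  proof (rule ccontr)
    assume nz: "d x \<noteq> 0"
    obtain C where C: "recurrent_class S q C" "C \<subseteq> {y \<in> S. d y > 0}"
      using has_class[OF d pos[OF sum0 nz]] by blast
    obtain C' where C': "recurrent_class S q C'" "C' \<subseteq> {y \<in> S. - d y > 0}"
      using has_class[OF balanced_uminus[OF d]] pos[of "\<lambda>y. - d y"] sum0 nz by (auto simp: sum_negf)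
    obtain y where "y \<in> C" using C(1) unfolding recurrent_class_def by blast
    moreover have "C = C'"
      using unique C(1) C'(1) by blast
    ultimately have "d y > 0" "- d y > 0" using C(2) C'(2) by blast+
    then show False by simp
  qed
qed

section \<open>Counting cars\<close>

text \<open>The flag separates full from empty cars. With one index set for both matrices, every
  transition moves a single car between two stations of a closed queueing network.\<close>

type_synonym 'r station = "bool \<times> 'r \<times> 'r"

definition cars :: "'r::finite state \<Rightarrow> 'r station \<Rightarrow> nat" where
  "cars x = (\<lambda>(full, i, j). (if full then snd x else fst x) $ i $ j)"

definition add_car :: "'r station \<Rightarrow> 'r::finite state \<Rightarrow> 'r state" where
  "add_car = (\<lambda>(full, i, j) x. if full then (fst x, snd x + unit_matrix i j)
     else (fst x + unit_matrix i j, snd x))"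

lemma cars_simps [simp]:
  "cars (E, F) (False, i, j) = E $ i $ j"
  "cars (E, F) (True, i, j) = F $ i $ j"
  by (auto simp: cars_def)

lemma cars_add_car: "cars (add_car k x) = (cars x)(k := Suc (cars x k))"
  by (cases k) (auto simp: cars_def add_car_def unit_matrix_def fun_eq_iff)

lemma cars_inject: "cars x = cars y \<longleftrightarrow> x = y"
proof
  assume *: "cars x = cars y"
  have "fst x $ i $ j = fst y $ i $ j" "snd x $ i $ j = snd y $ i $ j" for i j
    using fun_cong[OF *, of "(False, i, j)"] fun_cong[OF *, of "(True, i, j)"]
    by (auto simp: cars_def)
  then show "x = y" by (simp add: prod_eq_iff vec_eq_iff)
qed simp

lemma cars_surj: obtains x where "cars x = g"
proof
  show "cars ((\<chi> i j. g (False, i, j)), (\<chi> i j. g (True, i, j))) = g"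
    by (auto simp: cars_def fun_eq_iff)
qed

lemma inj_add_car: "inj (add_car k)"
proof (rule injI)
  fix x y assume "add_car k x = add_car k y"
  then have *: "(cars x)(k := Suc (cars x k)) = (cars y)(k := Suc (cars y k))"
    by (metis cars_add_car)
  have "cars x l = cars y l" for l
    using fun_cong[OF *, of l] by (auto split: if_splits)
  then have "cars x = cars y" by blast
  then show "x = y" by (simp add: cars_inject)
qed

lemma obtain_add_car:
  assumes "cars x k > 0"
  obtains z where "x = add_car k z"
proof -
  obtain z where z: "cars z = (cars x)(k := cars x k - 1)" by (rule cars_surj)
  then have "cars (add_car k z) = cars x"
    using assms by (simp add: cars_add_car)
  then have "x = add_car k z" by (simp flip: cars_inject)
  then show thesis by (rule that)
qed

lemma sum_station:
  fixes g :: "'r::finite station \<Rightarrow> 'b::comm_monoid_add"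
  shows "(\<Sum>k\<in>UNIV. g k) = (\<Sum>i\<in>UNIV. \<Sum>j\<in>UNIV. g (False, i, j) + g (True, i, j))"
proof -
  have "(\<Sum>k\<in>UNIV. g k) = (\<Sum>b\<in>UNIV. \<Sum>i\<in>UNIV. \<Sum>j\<in>UNIV. g (b, i, j))"
    by (simp add: sum.cartesian_product)
  then show ?thesis by (simp add: UNIV_bool sum.distrib add.commute)
qed

lemma car_states_iff: "x \<in> car_states N \<longleftrightarrow> (\<Sum>k\<in>UNIV. cars x k) = N"
  by (cases x) (simp add: car_states_def sum_station)

lemma add_car_in_car_states [simp]: "add_car k z \<in> car_states (Suc M) \<longleftrightarrow> z \<in> car_states M"
proof -
  have "(\<Sum>l\<in>UNIV. cars (add_car k z) l)
      = cars (add_car k z) k + (\<Sum>l\<in>UNIV - {k}. cars (add_car k z) l)"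
    by (rule sum.remove) auto
  also have "(\<Sum>l\<in>UNIV - {k}. cars (add_car k z) l) = (\<Sum>l\<in>UNIV - {k}. cars z l)"
    by (intro sum.cong) (auto simp: cars_add_car)
  also have "cars (add_car k z) k + \<dots> = Suc (cars z k + (\<Sum>l\<in>UNIV - {k}. cars z l))"
    by (simp add: cars_add_car)
  also have "cars z k + (\<Sum>l\<in>UNIV - {k}. cars z l) = (\<Sum>l\<in>UNIV. cars z l)"
    by (rule sum.remove[symmetric]) auto
  finally show ?thesis by (simp add: car_states_iff)
qed

section \<open>Sums over the states with a given number of cars\<close>

lemma
  shows finite_car_states [simp]: "finite (car_states N :: 'r::finite state set)"
    and card_car_states: "card (car_states N :: 'r state set) \<le> (N + 1) ^ CARD('r station)"
proof -
  let ?B = "PiE UNIV (\<lambda>_::'r station. {..N})"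
  have img: "cars ` car_states N \<subseteq> ?B"
  proof (intro subsetI)
    fix g :: "'r station \<Rightarrow> nat" assume "g \<in> cars ` car_states N"
    then obtain x where x: "x \<in> car_states N" "g = cars x" by auto
    have "cars x k \<le> (\<Sum>k\<in>UNIV. cars x k)" for k
      by (rule member_le_sum) auto
    then show "g \<in> ?B" using x by (auto simp: car_states_iff)
  qed
  have inj: "inj_on cars (car_states N :: 'r state set)"
    by (auto simp: inj_on_def cars_inject)
  have B: "finite ?B" by (intro finite_PiE) auto
  show "finite (car_states N :: 'r state set)"
    by (rule inj_on_finite[OF inj img B])
  show "card (car_states N :: 'r state set) \<le> (N + 1) ^ CARD('r station)"
    using card_inj_on_le[OF inj img B] by (simp add: card_PiE)
qed

text \<open>\<open>add_car k\<close> is a bijection from the states with one car fewer onto the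
  states with a car at \<open>k\<close>. This reindexing is behind the multinomial sum, the balance
  equations and the throughput.\<close>

lemma sum_car_states_shift:
  fixes g :: "'r::finite state \<Rightarrow> real"
  shows "(\<Sum>x\<in>car_states (Suc M). if cars x k > 0 then g x else 0)
       = (\<Sum>z\<in>car_states M. g (add_car k z))"
proof -
  have img: "{x \<in> car_states (Suc M). cars x k > 0} = add_car k ` car_states M"
  proof (intro equalityI subsetI)
    fix x assume x: "x \<in> {x \<in> car_states (Suc M). cars x k > 0}"
    then obtain z where "x = add_car k z" using obtain_add_car by blast
    with x show "x \<in> add_car k ` car_states M" by auto
  qed (auto simp: cars_add_car)
  have "(\<Sum>x\<in>car_states (Suc M). if cars x k > 0 then g x else 0)
      = (\<Sum>x\<in>{x \<in> car_states (Suc M). cars x k > 0}. g x)"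
    by (rule sum.inter_filter[symmetric]) simp
  also have "\<dots> = (\<Sum>z\<in>car_states M. g (add_car k z))"
    unfolding img by (subst sum.reindex) (auto intro: inj_on_subset[OF inj_add_car])
  finally show ?thesis .
qed

lemma prod_cars_add_car:
  fixes \<phi> :: "'r::finite station \<Rightarrow> nat \<Rightarrow> real"
  assumes "\<phi> k (Suc (cars z k)) * d = b * \<phi> k (cars z k)"
  shows "(\<Prod>l\<in>UNIV. \<phi> l (cars (add_car k z) l)) * d = b * (\<Prod>l\<in>UNIV. \<phi> l (cars z l))"
proof -
  have "(\<Prod>l\<in>UNIV. \<phi> l (cars (add_car k z) l))
      = \<phi> k (Suc (cars z k)) * (\<Prod>l\<in>UNIV - {k}. \<phi> l (cars (add_car k z) l))"
    by (subst prod.remove[of _ k]) (auto simp: cars_add_car)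
  also have "(\<Prod>l\<in>UNIV - {k}. \<phi> l (cars (add_car k z) l)) = (\<Prod>l\<in>UNIV - {k}. \<phi> l (cars z l))"
    by (intro prod.cong) (auto simp: cars_add_car)
  finally have "(\<Prod>l\<in>UNIV. \<phi> l (cars (add_car k z) l)) * d
      = (\<phi> k (Suc (cars z k)) * d) * (\<Prod>l\<in>UNIV - {k}. \<phi> l (cars z l))"
    by simp
  also have "\<dots> = b * (\<Prod>l\<in>UNIV. \<phi> l (cars z l))"
    by (subst assms) (simp add: prod.remove[of UNIV k])
  finally show ?thesis .
qed

text \<open>Induction by removing one car: the factor \<open>Suc M\<close> is the total of
  \<open>cars x k\<close> over all k, and each \<open>cars x k\<close> cancels against the
  factorial, which leaves a state with M cars.\<close>

lemma sum_car_states_multinomial: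
  fixes m :: "'r::finite station \<Rightarrow> real"
  assumes m: "(\<Sum>k\<in>UNIV. m k) = c"
  shows "(\<Sum>x\<in>car_states N. \<Prod>k\<in>UNIV. m k ^ cars x k / fact (cars x k)) = c ^ N / fact N"
proof (induction N)
  case 0
  obtain x0 :: "'r state" where x0: "cars x0 = (\<lambda>_. 0)" by (rule cars_surj)
  have "car_states 0 = {x0}"
    using x0 by (auto simp: car_states_iff fun_eq_iff simp flip: cars_inject)
  then show ?case by (simp add: x0)
next
  case (Suc M)
  define W where "W x = (\<Prod>k\<in>UNIV. m k ^ cars x k / fact (cars x k))" for x :: "'r state"
  have shift: "W (add_car k z) * real (Suc (cars z k)) = m k * W z" for k z
    unfolding W_def
    by (rule prod_cars_add_car[of "\<lambda>k n. m k ^ n / fact n"])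
       (simp del: of_nat_Suc)
  have "real (Suc M) * (\<Sum>x\<in>car_states (Suc M). W x)
      = (\<Sum>x\<in>car_states (Suc M). \<Sum>k\<in>UNIV. W x * real (cars x k))"
    unfolding sum_distrib_left
  proof (rule sum.cong[OF refl])
    fix x :: "'r state" assume "x \<in> car_states (Suc M)"
    then have "real (Suc M) = (\<Sum>k\<in>UNIV. real (cars x k))"
      unfolding car_states_iff by (metis of_nat_sum)
    then show "real (Suc M) * W x = (\<Sum>k\<in>UNIV. W x * real (cars x k))"
      by (simp only: sum_distrib_left mult.commute)
  qed
  also have "\<dots> = (\<Sum>k\<in>UNIV. \<Sum>x\<in>car_states (Suc M). if cars x k > 0 then W x * real (cars x k) else 0)"
    by (subst sum.swap) (auto intro!: sum.cong)
  also have "\<dots> = (\<Sum>k\<in>UNIV. \<Sum>z\<in>car_states M. m k * W z)"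
    using shift by (simp add: sum_car_states_shift cars_add_car)
  also have "\<dots> = (\<Sum>k\<in>UNIV. m k * (\<Sum>z\<in>car_states M. W z))"
    by (simp add: sum_distrib_left)
  also have "\<dots> = c * (\<Sum>z\<in>car_states M. W z)"
    by (simp add: m flip: sum_distrib_right)
  finally have "real (Suc M) * (\<Sum>x\<in>car_states (Suc M). W x) = c * (c ^ M / fact M)"
    using Suc by (simp only: W_def)
  then have "(\<Sum>x\<in>car_states (Suc M). W x) = c * (c ^ M / fact M) / real (Suc M)"
    by (simp add: field_simps del: of_nat_Suc)
  then show ?case
    by (simp add: W_def mult.commute del: of_nat_Suc)
qed

section \<open>Analytic estimates\<close>

text \<open>Both signs of t are needed, as the exponential tilt is applied to upper and lower tails.
  For negative t the bound reduces to 1 + s <= exp s.\<close>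

lemma exp_le_quadratic:
  fixes t :: real
  assumes "\<bar>t\<bar> \<le> 1"
  shows "exp t \<le> 1 + t + t\<^sup>2"
proof (cases "t \<ge> 0")
  case True
  then show ?thesis using assms exp_bound by simp
next
  case False
  define s where "s = - t"
  have s: "0 \<le> s" "s \<le> 1" using False assms by (auto simp: s_def)
  have "(1 - s + s\<^sup>2) * (1 + s) = 1 + s ^ 3"
    by (simp add: algebra_simps power2_eq_square power3_eq_cube)
  then have "1 \<le> (1 - s + s\<^sup>2) * (1 + s)" using s by simp
  also have "\<dots> \<le> (1 - s + s\<^sup>2) * exp s"
    using s by (intro mult_left_mono) auto
  finally have "exp (- s) \<le> 1 - s + s\<^sup>2"
    by (simp add: exp_minus field_simps)
  then show ?thesis by (simp add: s_def)
qed

section \<open>Poisson and geometric tails\<close>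

lemma power_over_fact_le_exp:
  fixes x :: real
  assumes "0 \<le> x"
  shows "x ^ n / fact n \<le> exp x"
proof -
  have "x ^ n / fact n \<le> (\<Sum>k\<le>n. x ^ k / fact k)"
    by (rule member_le_sum) (use assms in auto)
  also have "\<dots> \<le> exp x"
    using sum_le_suminf[OF summable_exp_generic[of x], of "{..n}"] assms
    by (simp add: exp_def divide_inverse mult.commute)
  finally show ?thesis .
qed

text \<open>Chernoff bound for Poisson terms that lack the normalisation exp (- N m). Multiplying
  the n-th term by exp (\<theta> n) gives a term of mean N m exp \<theta>, which is at most the
  exponential of that mean.\<close>

lemma poisson_deviation:
  fixes m :: real
  assumes m: "0 \<le> m" "m \<le> 1" and \<epsilon>: "0 < \<epsilon>" "\<epsilon> \<le> 1"
    and dev: "\<epsilon> * real N \<le> \<bar>real n - real N * m\<bar>"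
  shows "(real N * m) ^ n / fact n \<le> exp (real N * m - real N * (\<epsilon>\<^sup>2 / 4))"
proof -
  have tilt: "(real N * m) ^ n / fact n \<le> exp (real N * m * (1 + \<theta> + \<theta>\<^sup>2) - \<theta> * real n)"
    if "\<bar>\<theta>\<bar> \<le> 1" for \<theta>
  proof -
    have "(real N * m) ^ n / fact n = (real N * m * exp \<theta>) ^ n / fact n * exp (- (\<theta> * real n))"
      by (simp add: power_mult_distrib exp_of_nat_mult[symmetric] mult.commute exp_minus)
    also have "\<dots> \<le> exp (real N * m * exp \<theta>) * exp (- (\<theta> * real n))"
      using m by (intro mult_right_mono power_over_fact_le_exp) auto
    also have "\<dots> \<le> exp (real N * m * (1 + \<theta> + \<theta>\<^sup>2)) * exp (- (\<theta> * real n))"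
      using exp_le_quadratic[OF that] m by (intro mult_right_mono) (auto intro: mult_left_mono)
    finally show ?thesis by (simp add: exp_diff exp_minus divide_inverse)
  qed
  \<comment> \<open>The tilt is \<epsilon>/2 or -\<epsilon>/2: the deviation gains at least N
    \<epsilon>^2 / 2, while the second-order term costs at most N \<epsilon>^2 / 4 because m <=
    1.\<close>
  have msq: "real N * m * (\<epsilon>\<^sup>2 / 4) \<le> real N * 1 * (\<epsilon>\<^sup>2 / 4)"
    using m by (intro mult_right_mono mult_left_mono) auto
  consider "real n \<ge> real N * m + \<epsilon> * real N" | "real n \<le> real N * m - \<epsilon> * real N"
    using dev by linarith
  then show ?thesis
  proof cases
    case 1
    have "real N * m * (1 + \<epsilon>/2 + (\<epsilon>/2)\<^sup>2) - \<epsilon>/2 * real n \<le> real N * m - real N * (\<epsilon>\<^sup>2 / 4)"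
    proof -
      have "real N * m * (1 + \<epsilon>/2 + (\<epsilon>/2)\<^sup>2) - \<epsilon>/2 * real n
          = real N * m + real N * m * (\<epsilon>\<^sup>2 / 4) - real N * (\<epsilon>\<^sup>2 / 2)
            - \<epsilon>/2 * (real n - (real N * m + \<epsilon> * real N))"
        by (simp add: field_simps power2_eq_square)
      moreover have "0 \<le> \<epsilon>/2 * (real n - (real N * m + \<epsilon> * real N))"
        using 1 \<epsilon> by (intro mult_nonneg_nonneg) auto
      ultimately show ?thesis using msq by linarith
    qed
    then show ?thesis
      using tilt[of "\<epsilon>/2"] \<epsilon> by (simp add: order_trans[OF _ exp_le_cancel_iff[THEN iffD2]])
  next
    case 2
    have "real N * m * (1 + -\<epsilon>/2 + (-\<epsilon>/2)\<^sup>2) - (-\<epsilon>/2) * real n \<le> real N * m - real N * (\<epsilon>\<^sup>2 / 4)"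
    proof -
      have "real N * m * (1 + -\<epsilon>/2 + (-\<epsilon>/2)\<^sup>2) - (-\<epsilon>/2) * real n
          = real N * m + real N * m * (\<epsilon>\<^sup>2 / 4) - real N * (\<epsilon>\<^sup>2 / 2)
            - \<epsilon>/2 * ((real N * m - \<epsilon> * real N) - real n)"
        by (simp add: field_simps power2_eq_square)
      moreover have "0 \<le> \<epsilon>/2 * ((real N * m - \<epsilon> * real N) - real n)"
        using 2 \<epsilon> by (intro mult_nonneg_nonneg) auto
      ultimately show ?thesis using msq by linarith
    qed
    then show ?thesis
      using tilt[of "-\<epsilon>/2"] \<epsilon> by (simp add: order_trans[OF _ exp_le_cancel_iff[THEN iffD2]])
  qed
qed

lemma geometric_deviation:
  fixes \<alpha> :: real
  assumes "0 \<le> \<alpha>" "\<alpha> < 1" "0 < \<epsilon>"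
  obtains c where "0 < c" "\<And>N n. \<epsilon> * real N \<le> real n \<Longrightarrow> \<alpha> ^ n \<le> exp (- (real N * c))"
proof
  \<comment> \<open>As \<alpha> may be 0, where \<open>ln\<close> yields no decay rate, it is
    replaced by a larger base that lies strictly between 0 and 1.\<close>
  define b where "b = max \<alpha> (1/2)"
  have b: "0 < b" "b < 1" "\<alpha> \<le> b" using assms by (auto simp: b_def)
  show "0 < - (\<epsilon> * ln b)" using b assms by (simp add: mult_less_0_iff)
  fix N n assume n: "\<epsilon> * real N \<le> real n"
  have "\<alpha> ^ n \<le> b ^ n" using b assms by (intro power_mono) auto
  also have "b ^ n = exp (real n * ln b)" using b by (simp add: exp_of_nat_mult)
  also have "\<dots> \<le> exp (\<epsilon> * real N * ln b)"
    using n b by (simp add: mult_right_mono_neg)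
  finally show "\<alpha> ^ n \<le> exp (- (real N * - (\<epsilon> * ln b)))" by (simp add: mult_ac)
qed

text \<open>The crude factor e n is harmless against exponential decay. The induction step is the
  inequality (1 + 1/u)^(u + 1) >= e.\<close>

lemma fact_le_Stirling:
  assumes "0 < n"
  shows "fact n \<le> exp 1 * real n * (real n / exp 1) ^ n"
proof -
  have "fact (Suc m) \<le> exp 1 * real (Suc m) * (real (Suc m) / exp 1) ^ Suc m" for m
  proof (induction m)
    case (Suc m)
    define u where "u = real (Suc m)"
    have u: "u > 0" by (simp add: u_def)
    have "1 - u / (u + 1) \<le> - ln (u / (u + 1))"
      using ln_le_minus_one[of "u / (u + 1)"] u by simp
    then have "1 / (u + 1) \<le> ln ((u + 1) / u)"
      using u by (simp add: ln_div field_simps)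
    then have "1 \<le> (u + 1) * ln ((u + 1) / u)" using u by (simp add: field_simps)
    then have "exp 1 \<le> exp (real (Suc (Suc m)) * ln ((u + 1) / u))" by (simp add: u_def add.commute)
    also have "\<dots> = ((u + 1) / u) ^ Suc (Suc m)"
      using u by (subst exp_of_nat_mult) simp
    finally have e: "exp 1 * u ^ Suc (Suc m) \<le> (u + 1) ^ Suc (Suc m)"
      using u by (simp add: power_divide field_simps)
    have "fact (Suc (Suc m)) = (u + 1) * fact (Suc m)"
      by (simp add: u_def algebra_simps)
    also have "\<dots> \<le> (u + 1) * (exp 1 * u * (u / exp 1) ^ Suc m)"
      using Suc u by (intro mult_left_mono) (auto simp: u_def)
    also have "\<dots> = (u + 1) * exp 1 * (exp 1 * u ^ Suc (Suc m)) / exp 1 ^ Suc (Suc m)"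
      by (simp add: power_divide)
    also have "\<dots> \<le> (u + 1) * exp 1 * (u + 1) ^ Suc (Suc m) / exp 1 ^ Suc (Suc m)"
      using e u by (intro divide_right_mono mult_left_mono) auto
    also have "\<dots> = exp 1 * real (Suc (Suc m)) * (real (Suc (Suc m)) / exp 1) ^ Suc (Suc m)"
      by (simp add: u_def power_divide add.commute mult.commute)
    finally show ?case .
  qed simp
  then show ?thesis using assms gr0_implies_Suc by blast
qed

lemma power_mult_exp_tendsto_0:
  fixes c :: real
  assumes "0 < c"
  shows "(\<lambda>n. real n ^ d * exp (- (real n * c))) \<longlonglongrightarrow> 0"
proof -
  have "((\<lambda>x. x ^ d / exp x) \<longlongrightarrow> (0::real)) at_top" by (rule tendsto_power_div_exp_0)
  moreover have "filterlim (\<lambda>n. c * real n) at_top sequentially"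
    using assms by (intro filterlim_tendsto_pos_mult_at_top[OF tendsto_const _ filterlim_real_sequentially])
  ultimately have "(\<lambda>n. (c * real n) ^ d / exp (c * real n)) \<longlonglongrightarrow> 0"
    by (rule filterlim_compose)
  then have "(\<lambda>n. (1 / c ^ d) * ((c * real n) ^ d / exp (c * real n))) \<longlonglongrightarrow> 1 / c ^ d * 0"
    by (intro tendsto_mult tendsto_const)
  moreover have "(1 / c ^ d) * ((c * real n) ^ d / exp (c * real n)) = real n ^ d * exp (- (real n * c))" for n
    using assms by (simp add: power_mult_distrib exp_minus field_simps)
  ultimately show ?thesis by simp
qed

section \<open>Convergence in probability to a constant implies convergence in law\<close>

lemma converges_in_law_to_constI:
  fixes X :: "nat \<Rightarrow> 's \<Rightarrow> 'a::metric_space"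
  assumes prob: "\<And>\<epsilon>. 0 < \<epsilon> \<Longrightarrow> (\<lambda>N. measure_pmf.prob (\<pi> N) {x. \<epsilon> \<le> dist (X N x) c}) \<longlonglongrightarrow> 0"
  shows "converges_in_law_to_const \<pi> X c"
  unfolding converges_in_law_to_const_def weakly_converges_def
proof (intro allI impI)
  fix g :: "'a \<Rightarrow> real" assume g: "continuous_on UNIV g \<and> bounded (range g)"
  then obtain B where B: "\<And>x. \<bar>g x\<bar> \<le> B" by (auto simp: bounded_iff)
  then have B0: "0 \<le> B" using abs_ge_zero order_trans by blast
  have meas: "g \<in> borel_measurable borel"
    using g by (simp add: borel_measurable_continuous_onI)
  have int: "integrable (measure_pmf (\<pi> N)) (\<lambda>x. g (X N x))" for N
    by (rule measure_pmf.integrable_const_bound[of _ B]) (auto simp: B)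
  have lhs: "(\<integral>x. g x \<partial>law (\<pi> N) (X N)) = measure_pmf.expectation (\<pi> N) (\<lambda>x. g (X N x))" for N
    unfolding law_def using meas by (subst integral_distr) auto
  have rhs: "(\<integral>x. g x \<partial>return borel c) = g c"
    using meas by (subst integral_return) auto
  show "(\<lambda>N. \<integral>x. g x \<partial>law (\<pi> N) (X N)) \<longlonglongrightarrow> (\<integral>x. g x \<partial>return borel c)"
    unfolding lhs rhs
  proof (rule LIMSEQ_I)
    fix \<eta> :: real assume \<eta>: "0 < \<eta>"
    have "isCont g c" using g by (simp add: continuous_on_eq_continuous_at)
    then obtain \<epsilon> where \<epsilon>: "0 < \<epsilon>" "\<And>y. dist y c < \<epsilon> \<Longrightarrow> \<bar>g y - g c\<bar> < \<eta> / 2"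
      unfolding continuous_at_eps_delta dist_real_def using \<eta> by (meson half_gt_zero)
    define A where "A N = {x. \<epsilon> \<le> dist (X N x) c}" for N
    have ind: "integrable (measure_pmf (\<pi> N)) (indicat_real (A N))" for N
      by (rule measure_pmf.integrable_const_bound[of _ 1]) auto
    have bound: "\<bar>measure_pmf.expectation (\<pi> N) (\<lambda>x. g (X N x)) - g c\<bar>
        \<le> \<eta> / 2 + 2 * B * measure_pmf.prob (\<pi> N) (A N)" for N
    proof -
      have "measure_pmf.expectation (\<pi> N) (\<lambda>x. g (X N x)) - g c
          = measure_pmf.expectation (\<pi> N) (\<lambda>x. g (X N x) - g c)"
        using int by (simp add: Bochner_Integration.integral_diff)
      also have "\<bar>\<dots>\<bar> \<le> measure_pmf.expectation (\<pi> N) (\<lambda>x. \<bar>g (X N x) - g c\<bar>)"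
        by (rule integral_abs_bound)
      also have "\<dots> \<le> measure_pmf.expectation (\<pi> N) (\<lambda>x. \<eta> / 2 + 2 * B * indicator (A N) x)"
      proof (rule integral_mono)
        show le: "\<bar>g (X N x) - g c\<bar> \<le> \<eta> / 2 + 2 * B * indicator (A N) x" for x
          using \<epsilon>(2)[of "X N x"] B[of "X N x"] B[of c] \<eta>
          by (auto simp: A_def indicator_def not_le)
        show "integrable (measure_pmf (\<pi> N)) (\<lambda>x. \<bar>g (X N x) - g c\<bar>)"
          using int by simp
        show "integrable (measure_pmf (\<pi> N)) (\<lambda>x. \<eta> / 2 + 2 * B * indicator (A N) x)"
          by (rule measure_pmf.integrable_const_bound[of _ "\<eta> / 2 + 2 * B"])
             (use B0 \<eta> in \<open>auto simp: indicator_def\<close>)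
      qed
      also have "\<dots> = \<eta> / 2 + 2 * B * measure_pmf.prob (\<pi> N) (A N)"
        by (subst Bochner_Integration.integral_add) (auto simp: ind)
      finally show ?thesis .
    qed
    have "(\<lambda>N. \<eta> / 2 + 2 * B * measure_pmf.prob (\<pi> N) (A N)) \<longlonglongrightarrow> \<eta> / 2 + 2 * B * 0"
      unfolding A_def by (intro tendsto_intros prob \<epsilon>)
    then have "\<forall>\<^sub>F N in sequentially. \<eta> / 2 + 2 * B * measure_pmf.prob (\<pi> N) (A N) < \<eta>"
      by (rule order_tendstoD) (use \<eta> in simp)
    then show "\<exists>n0. \<forall>n\<ge>n0. norm (measure_pmf.expectation (\<pi> n) (\<lambda>x. g (X n x)) - g c) < \<eta>"
      unfolding eventually_sequentially using bound by (auto intro: le_less_trans)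
  qed
qed

section \<open>The product-form invariant measure\<close>

definition remove_car :: "'r station \<Rightarrow> 'r::finite state \<Rightarrow> 'r state" where
  "remove_car = (\<lambda>(full, i, j) x. if full then (fst x, snd x - unit_matrix i j)
     else (fst x - unit_matrix i j, snd x))"

lemma remove_add_car [simp]: "remove_car k (add_car k z) = z"
proof -
  have "A + unit_matrix i j - unit_matrix i j = A" for A and i j :: 'a
    by (simp add: vec_eq_iff)
  then show ?thesis by (cases k) (simp add: remove_car_def add_car_def)
qed

definition is_queue :: "'r station \<Rightarrow> bool" where
  "is_queue = (\<lambda>(full, i, j). \<not> full \<and> i = j)"

lemma is_queue_simps [simp]:
  "is_queue (False, i, j) \<longleftrightarrow> i = j" "\<not> is_queue (True, i, j)"
  by (auto simp: is_queue_def)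

text \<open>The number of busy servers: a queue of waiting cars is emptied at a rate independent of
  its length, whereas every travelling car moves on by itself.\<close>

definition service :: "'r station \<Rightarrow> nat \<Rightarrow> real" where
  "service k n = (if is_queue k then (if n > 0 then 1 else 0) else real n)"

lemma service_nonneg: "0 \<le> service k n"
  by (simp add: service_def)

text \<open>Brings the three kinds of transition to one shape, a move between two stations at a rate
  proportional to \<open>service\<close>, so that a single lemma can treat them all.\<close>

lemma car_rate_eq:
  "car_rate N \<Lambda> \<mu> P Q x y =
     (\<Sum>i\<in>UNIV. \<Sum>j\<in>UNIV. if y = add_car (True, i, j) (remove_car (False, i, i) x)
        then real N * \<Lambda> $ i * P $ i $ j * service (False, i, i) (cars x (False, i, i)) else 0)
   + (\<Sum>i\<in>UNIV. \<Sum>j\<in>UNIV. \<Sum>k\<in>UNIV. if y = add_car (False, j, k) (remove_car (True, i, j) x)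
        then \<mu> $ i $ j * Q $ j $ k * service (True, i, j) (cars x (True, i, j)) else 0)
   + (\<Sum>i\<in>UNIV. \<Sum>j\<in>UNIV - {i}. if y = add_car (False, j, j) (remove_car (False, i, j) x)
        then \<mu> $ i $ j * service (False, i, j) (cars x (False, i, j)) else 0)"
proof -
  obtain E F where x: "x = (E, F)" by (cases x)
  show ?thesis
    unfolding x car_rate_def
    by (auto simp: add_car_def remove_car_def service_def intro!: arg_cong2[of _ _ _ _ "(+)"] sum.cong
        cong: if_cong)
qed

text \<open>If station \<open>k\<close> is empty, truncated subtraction gives a target with one car
  too many, outside the state space; but then \<open>service\<close> vanishes and both sides are
  0.\<close>

lemma sum_move:
  assumes x: "x \<in> car_states (Suc M)"
  shows "(\<Sum>y\<in>car_states (Suc M). (if y = add_car l (remove_car k x)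
            then c * service k (cars x k) else 0) * g y)
       = c * service k (cars x k) * g (add_car l (remove_car k x))"
proof (cases "cars x k > 0")
  case True
  then obtain z where z: "x = add_car k z" using obtain_add_car by blast
  then have "add_car l (remove_car k x) \<in> car_states (Suc M)" using x by simp
  then show ?thesis by (simp add: if_distrib[of "\<lambda>t. t * _"] sum.delta cong: if_cong)
next
  case False
  then have "service k (cars x k) = 0" by (simp add: service_def)
  then show ?thesis by (simp cong: if_cong)
qed

lemma sum_car_rate:
  assumes x: "x \<in> car_states (Suc M)"
  shows "(\<Sum>y\<in>car_states (Suc M). car_rate N \<Lambda> \<mu> P Q x y * g y) =
     (\<Sum>i\<in>UNIV. \<Sum>j\<in>UNIV. real N * \<Lambda> $ i * P $ i $ j * service (False, i, i) (cars x (False, i, i))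
        * g (add_car (True, i, j) (remove_car (False, i, i) x)))
   + (\<Sum>i\<in>UNIV. \<Sum>j\<in>UNIV. \<Sum>k\<in>UNIV. \<mu> $ i $ j * Q $ j $ k * service (True, i, j) (cars x (True, i, j))
        * g (add_car (False, j, k) (remove_car (True, i, j) x)))
   + (\<Sum>i\<in>UNIV. \<Sum>j\<in>UNIV - {i}. \<mu> $ i $ j * service (False, i, j) (cars x (False, i, j))
        * g (add_car (False, j, j) (remove_car (False, i, j) x)))"
proof -
  let ?S = "car_states (Suc M)"
  have "(\<Sum>y\<in>?S. car_rate N \<Lambda> \<mu> P Q x y * g y) =
     (\<Sum>y\<in>?S. \<Sum>i\<in>UNIV. \<Sum>j\<in>UNIV. (if y = add_car (True, i, j) (remove_car (False, i, i) x)
        then real N * \<Lambda> $ i * P $ i $ j * service (False, i, i) (cars x (False, i, i)) else 0) * g y)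
   + (\<Sum>y\<in>?S. \<Sum>i\<in>UNIV. \<Sum>j\<in>UNIV. \<Sum>k\<in>UNIV. (if y = add_car (False, j, k) (remove_car (True, i, j) x)
        then \<mu> $ i $ j * Q $ j $ k * service (True, i, j) (cars x (True, i, j)) else 0) * g y)
   + (\<Sum>y\<in>?S. \<Sum>i\<in>UNIV. \<Sum>j\<in>UNIV - {i}. (if y = add_car (False, j, j) (remove_car (False, i, j) x)
        then \<mu> $ i $ j * service (False, i, j) (cars x (False, i, j)) else 0) * g y)"
    unfolding car_rate_eq by (simp only: sum.distrib distrib_right sum_distrib_right)
  also have "(\<Sum>y\<in>?S. \<Sum>i\<in>UNIV. \<Sum>j\<in>UNIV. (if y = add_car (True, i, j) (remove_car (False, i, i) x)
        then real N * \<Lambda> $ i * P $ i $ j * service (False, i, i) (cars x (False, i, i)) else 0) * g y)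
      = (\<Sum>i\<in>UNIV. \<Sum>j\<in>UNIV. \<Sum>y\<in>?S. (if y = add_car (True, i, j) (remove_car (False, i, i) x)
        then real N * \<Lambda> $ i * P $ i $ j * service (False, i, i) (cars x (False, i, i)) else 0) * g y)"
    by (subst sum.swap, intro sum.cong refl, rule sum.swap)
  also have "(\<Sum>y\<in>?S. \<Sum>i\<in>UNIV. \<Sum>j\<in>UNIV. \<Sum>k\<in>UNIV. (if y = add_car (False, j, k) (remove_car (True, i, j) x)
        then \<mu> $ i $ j * Q $ j $ k * service (True, i, j) (cars x (True, i, j)) else 0) * g y)
      = (\<Sum>i\<in>UNIV. \<Sum>j\<in>UNIV. \<Sum>k\<in>UNIV. \<Sum>y\<in>?S. (if y = add_car (False, j, k) (remove_car (True, i, j) x)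
        then \<mu> $ i $ j * Q $ j $ k * service (True, i, j) (cars x (True, i, j)) else 0) * g y)"
    by (subst sum.swap, intro sum.cong refl, subst sum.swap, intro sum.cong refl, rule sum.swap)
  also have "(\<Sum>y\<in>?S. \<Sum>i\<in>UNIV. \<Sum>j\<in>UNIV - {i}. (if y = add_car (False, j, j) (remove_car (False, i, j) x)
        then \<mu> $ i $ j * service (False, i, j) (cars x (False, i, j)) else 0) * g y)
      = (\<Sum>i\<in>UNIV. \<Sum>j\<in>UNIV - {i}. \<Sum>y\<in>?S. (if y = add_car (False, j, j) (remove_car (False, i, j) x)
        then \<mu> $ i $ j * service (False, i, j) (cars x (False, i, j)) else 0) * g y)"
    by (subst sum.swap, intro sum.cong refl, rule sum.swap)
  finally show ?thesis by (simp only: sum_move[OF x])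
qed

section \<open>Traffic equations and product weights\<close>

locale fluid_solution =
  fixes \<Lambda> a :: "real ^ 'r::finite"
    and \<mu> P q e f :: "real ^ 'r ^ 'r"
  assumes \<Lambda>_pos: "\<And>i. 0 < \<Lambda> $ i"
    and \<mu>_pos: "\<And>i j. 0 < \<mu> $ i $ j"
    and P_stochastic: "row_stochastic P"
    and feasible: "fluid_feasible \<Lambda> \<mu> P q e f a"
    and P_pos: "\<And>i j. 0 < P $ i $ j"
begin

lemma
  shows full_balance: "\<Lambda> $ i * P $ i $ j * a $ i = \<mu> $ i $ j * f $ i $ j"
    and empty_balance: "i \<noteq> j \<Longrightarrow>
      \<mu> $ i $ j * e $ i $ j = q $ i $ j * (\<Sum>k\<in>UNIV. \<mu> $ k $ i * f $ k $ i)"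
    and queue_balance: "\<Lambda> $ i * a $ i = (\<Sum>k\<in>UNIV - {i}. \<mu> $ k $ i * e $ k $ i)
      + q $ i $ i * (\<Sum>k\<in>UNIV. \<mu> $ k $ i * f $ k $ i)"
    and complementary: "(1 - a $ i) * e $ i $ i = 0"
    and a_range: "0 \<le> a $ i" "a $ i \<le> 1"
    and e_range: "0 \<le> e $ i $ j" "e $ i $ j \<le> 1"
    and f_range: "0 \<le> f $ i $ j" "f $ i $ j \<le> 1"
    and mass: "(\<Sum>i\<in>UNIV. \<Sum>j\<in>UNIV. e $ i $ j + f $ i $ j) = 1"
    and P_row: "(\<Sum>j\<in>UNIV. P $ i $ j) = 1"
    and q_row: "(\<Sum>j\<in>UNIV. q $ i $ j) = 1"
    and q_nonneg: "0 \<le> q $ i $ j"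
  using feasible P_stochastic
  by (auto simp: fluid_feasible_def fluid_simplex_def row_stochastic_def)

definition mean :: "'r station \<Rightarrow> real" where
  "mean = (\<lambda>(full, i, j). (if full then f else e) $ i $ j)"

lemma mean_simps [simp]: "mean (True, i, j) = f $ i $ j" "mean (False, i, j) = e $ i $ j"
  by (simp_all add: mean_def)

lemma mean_range: "0 \<le> mean k" "mean k \<le> 1"
  using e_range f_range by (cases k; auto simp: mean_def)+

lemma sum_mean: "(\<Sum>k\<in>UNIV. mean k) = 1"
  by (simp add: sum_station mass)

text \<open>Flow divided by the rate of one server. A queue carries the flow N \<lambda>_i a_i at
  rate N \<lambda>_i; the other stations carry N \<mu>_ij f_ij or N \<mu>_ij e_ij at rate \<mu>_ij
  per car.\<close>

definition load :: "nat \<Rightarrow> 'r station \<Rightarrow> real" where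
  "load N k = (if is_queue k then a $ fst (snd k) else real N * mean k)"

definition station_weight :: "nat \<Rightarrow> 'r station \<Rightarrow> nat \<Rightarrow> real" where
  "station_weight N k n = (if is_queue k then load N k ^ n else load N k ^ n / fact n)"

definition weight :: "nat \<Rightarrow> 'r state \<Rightarrow> real" where
  "weight N x = (\<Prod>k\<in>UNIV. station_weight N k (cars x k))"

lemma load_nonneg: "0 \<le> load N k"
  using a_range mean_range by (auto simp: load_def)

lemma station_weight_nonneg: "0 \<le> station_weight N k n"
  using load_nonneg by (simp add: station_weight_def)

lemma weight_add_car: "weight N (add_car k z) * service k (Suc (cars z k)) = load N k * weight N z"
  unfolding weight_def
  by (rule prod_cars_add_car) (simp add: station_weight_def service_def del: of_nat_Suc)

text \<open>An arrival theorem: a car that leaves \<open>k\<close> sees the network with one car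
  fewer. The parameter \<open>N\<close> of the weights is only the scaling and stays fixed, while
  the number of cars drops from \<open>Suc M\<close> to \<open>M\<close>.\<close>

lemma sum_weight_service:
  "(\<Sum>x\<in>car_states (Suc M). weight N x * (service k (cars x k) * g x))
   = load N k * (\<Sum>z\<in>car_states M. weight N z * g (add_car k z))"
proof -
  have "(\<Sum>x\<in>car_states (Suc M). weight N x * (service k (cars x k) * g x))
      = (\<Sum>x\<in>car_states (Suc M). if cars x k > 0 then weight N x * service k (cars x k) * g x else 0)"
    by (intro sum.cong) (auto simp: service_def)
  also have "\<dots> = (\<Sum>z\<in>car_states M. load N k * weight N z * g (add_car k z))"
    by (simp add: sum_car_states_shift cars_add_car weight_add_car)
  finally show ?thesis by (simp add: sum_distrib_left mult.assoc)
qed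

lemma sum_weight_move:
  "(\<Sum>x\<in>car_states (Suc M). weight N x * (c * service k (cars x k) *
      (h (add_car l (remove_car k x)) - h x)))
   = c * load N k * ((\<Sum>z\<in>car_states M. weight N z * h (add_car l z))
      - (\<Sum>z\<in>car_states M. weight N z * h (add_car k z)))"
proof -
  have "(\<Sum>x\<in>car_states (Suc M). weight N x * (c * service k (cars x k) *
      (h (add_car l (remove_car k x)) - h x)))
    = c * (\<Sum>x\<in>car_states (Suc M). weight N x * (service k (cars x k) *
      (h (add_car l (remove_car k x)) - h x)))"
    by (simp add: sum_distrib_left mult_ac)
  also have "\<dots> = c * (load N k * (\<Sum>z\<in>car_states M. weight N z * (h (add_car l z) - h (add_car k z))))"
    by (subst sum_weight_service) simp
  finally show ?thesis by (simp add: right_diff_distrib sum_subtractf mult.assoc)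
qed

text \<open>With \<open>HE i j\<close> and \<open>HF i j\<close> the weighted mean of a test function after one more car has joined
  the station \<open>E $ i $ j\<close> or \<open>F $ i $ j\<close>, the generator applied to the test function averages
  to this expression.\<close>

lemma fluid_balance:
  "(\<Sum>i\<in>UNIV. \<Sum>j\<in>UNIV. \<Lambda> $ i * P $ i $ j * a $ i * (HF i j - HE i i))
   + (\<Sum>i\<in>UNIV. \<Sum>j\<in>UNIV. \<Sum>k\<in>UNIV. \<mu> $ i $ j * q $ j $ k * f $ i $ j * (HE j k - HF i j))
   + (\<Sum>i\<in>UNIV. \<Sum>j\<in>UNIV - {i}. \<mu> $ i $ j * e $ i $ j * (HE j j - HE i j)) = (0::real)"
proof -
  define fl where "fl j = (\<Sum>i\<in>UNIV. \<mu> $ i $ j * f $ i $ j)" for j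
  \<comment> \<open>\<open>X\<close> and \<open>Y\<close> collect the traffic through the stations
    of full cars and of travelling empty cars. Each occurs once as arrivals and once as departures
    and cancels; what remains at the queues is \<open>queue_balance\<close>.\<close>
  define X where "X = (\<Sum>i\<in>UNIV. \<Sum>j\<in>UNIV. \<mu> $ i $ j * f $ i $ j * HF i j)"
  define Y where "Y = (\<Sum>i\<in>UNIV. \<Sum>j\<in>UNIV - {i}. \<mu> $ i $ j * e $ i $ j * HE i j)"
  have A: "(\<Sum>i\<in>UNIV. \<Sum>j\<in>UNIV. \<Lambda> $ i * P $ i $ j * a $ i * (HF i j - HE i i))
      = X - (\<Sum>i\<in>UNIV. \<Lambda> $ i * a $ i * HE i i)"
  proof -
    have "(\<Sum>j\<in>UNIV. \<Lambda> $ i * P $ i $ j * a $ i * (HF i j - HE i i))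
        = (\<Sum>j\<in>UNIV. \<mu> $ i $ j * f $ i $ j * HF i j) - \<Lambda> $ i * a $ i * HE i i" for i
    proof -
      have "(\<Sum>j\<in>UNIV. \<Lambda> $ i * P $ i $ j * a $ i * HE i i) = (\<Sum>j\<in>UNIV. P $ i $ j) * (\<Lambda> $ i * a $ i * HE i i)"
        unfolding sum_distrib_right by (simp add: mult_ac)
      then show ?thesis
        by (simp add: right_diff_distrib sum_subtractf P_row full_balance)
    qed
    then show ?thesis by (simp add: X_def sum_subtractf)
  qed
  have B: "(\<Sum>i\<in>UNIV. \<Sum>j\<in>UNIV. \<Sum>k\<in>UNIV. \<mu> $ i $ j * q $ j $ k * f $ i $ j * (HE j k - HF i j))
      = Y + (\<Sum>j\<in>UNIV. q $ j $ j * fl j * HE j j) - X"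
  proof -
    have k: "(\<Sum>k\<in>UNIV. \<mu> $ i $ j * q $ j $ k * f $ i $ j * (HE j k - HF i j))
        = \<mu> $ i $ j * f $ i $ j * (\<Sum>k\<in>UNIV. q $ j $ k * HE j k) - \<mu> $ i $ j * f $ i $ j * HF i j" for i j
    proof -
      have "(\<Sum>k\<in>UNIV. \<mu> $ i $ j * q $ j $ k * f $ i $ j * HF i j)
          = (\<Sum>k\<in>UNIV. q $ j $ k) * (\<mu> $ i $ j * f $ i $ j * HF i j)"
        unfolding sum_distrib_right by (simp add: mult_ac)
      then show ?thesis
        by (simp add: right_diff_distrib sum_subtractf q_row sum_distrib_left mult_ac)
    qed
    have "(\<Sum>i\<in>UNIV. \<Sum>j\<in>UNIV. \<mu> $ i $ j * f $ i $ j * (\<Sum>k\<in>UNIV. q $ j $ k * HE j k))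
        = (\<Sum>j\<in>UNIV. fl j * (\<Sum>k\<in>UNIV. q $ j $ k * HE j k))"
      by (subst sum.swap) (simp add: fl_def sum_distrib_right)
    also have "\<dots> = (\<Sum>j\<in>UNIV. (\<Sum>k\<in>UNIV - {j}. \<mu> $ j $ k * e $ j $ k * HE j k) + q $ j $ j * fl j * HE j j)"
    proof (rule sum.cong[OF refl])
      fix j
      have "fl j * (\<Sum>k\<in>UNIV. q $ j $ k * HE j k) = (\<Sum>k\<in>UNIV. q $ j $ k * fl j * HE j k)"
        by (simp add: sum_distrib_left mult_ac)
      also have "\<dots> = q $ j $ j * fl j * HE j j + (\<Sum>k\<in>UNIV - {j}. q $ j $ k * fl j * HE j k)"
        by (simp add: sum.remove)
      also have "(\<Sum>k\<in>UNIV - {j}. q $ j $ k * fl j * HE j k)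
          = (\<Sum>k\<in>UNIV - {j}. \<mu> $ j $ k * e $ j $ k * HE j k)"
        by (intro sum.cong) (auto simp: empty_balance fl_def)
      finally show "fl j * (\<Sum>k\<in>UNIV. q $ j $ k * HE j k)
          = (\<Sum>k\<in>UNIV - {j}. \<mu> $ j $ k * e $ j $ k * HE j k) + q $ j $ j * fl j * HE j j" by simp
    qed
    finally show ?thesis
      unfolding k by (simp add: sum_subtractf sum.distrib X_def Y_def)
  qed
  have C: "(\<Sum>i\<in>UNIV. \<Sum>j\<in>UNIV - {i}. \<mu> $ i $ j * e $ i $ j * (HE j j - HE i j))
      = (\<Sum>j\<in>UNIV. (\<Sum>i\<in>UNIV - {j}. \<mu> $ i $ j * e $ i $ j) * HE j j) - Y"
  proof -
    have *: "(\<Sum>j\<in>UNIV - {i}. g j) = (\<Sum>j\<in>UNIV. if i \<noteq> j then g j else 0)" for i :: 'r and g :: "'r \<Rightarrow> real"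
      by (rule sum.mono_neutral_cong_left) auto
    have "(\<Sum>i\<in>UNIV. \<Sum>j\<in>UNIV - {i}. \<mu> $ i $ j * e $ i $ j * HE j j)
        = (\<Sum>j\<in>UNIV. \<Sum>i\<in>UNIV - {j}. \<mu> $ i $ j * e $ i $ j * HE j j)"
      unfolding * by (subst sum.swap) (auto intro!: sum.cong)
    then show ?thesis
      by (simp add: right_diff_distrib sum_subtractf Y_def sum_distrib_right)
  qed
  have D: "(\<Sum>i\<in>UNIV. \<Lambda> $ i * a $ i * HE i i)
      = (\<Sum>j\<in>UNIV. (\<Sum>i\<in>UNIV - {j}. \<mu> $ i $ j * e $ i $ j) * HE j j) + (\<Sum>j\<in>UNIV. q $ j $ j * fl j * HE j j)"
    by (simp add: queue_balance fl_def distrib_right sum.distrib)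
  show ?thesis unfolding A B C D by simp
qed

text \<open>By \<open>sum_weight_move\<close> each move contributes rate times load times the
  difference of \<open>H\<close> between target and source. A factor N comes from the request rate
  at the queues and from the load at the other stations, so it factors out and
  \<open>fluid_balance\<close> remains.\<close>

lemma weight_balanced: "balanced (car_states (Suc M)) (car_rate N \<Lambda> \<mu> P q) (weight N)"
  unfolding balanced_def
proof
  fix h :: "'r state \<Rightarrow> real"
  let ?S = "car_states (Suc M)"
  define H where "H k = (\<Sum>z\<in>car_states M. weight N z * h (add_car k z))" for k
  have "(\<Sum>x\<in>?S. weight N x * (\<Sum>y\<in>?S. car_rate N \<Lambda> \<mu> P q x y * (h y - h x)))
    = (\<Sum>x\<in>?S. \<Sum>i\<in>UNIV. \<Sum>j\<in>UNIV. weight N x * (real N * \<Lambda> $ i * P $ i $ j * service (False, i, i) (cars x (False, i, i))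
        * (h (add_car (True, i, j) (remove_car (False, i, i) x)) - h x)))
   + (\<Sum>x\<in>?S. \<Sum>i\<in>UNIV. \<Sum>j\<in>UNIV. \<Sum>k\<in>UNIV. weight N x * (\<mu> $ i $ j * q $ j $ k * service (True, i, j) (cars x (True, i, j))
        * (h (add_car (False, j, k) (remove_car (True, i, j) x)) - h x)))
   + (\<Sum>x\<in>?S. \<Sum>i\<in>UNIV. \<Sum>j\<in>UNIV - {i}. weight N x * (\<mu> $ i $ j * service (False, i, j) (cars x (False, i, j))
        * (h (add_car (False, j, j) (remove_car (False, i, j) x)) - h x)))"
    by (simp add: sum_car_rate distrib_left sum.distrib sum_distrib_left cong: sum.cong)
  also have "(\<Sum>x\<in>?S. \<Sum>i\<in>UNIV. \<Sum>j\<in>UNIV. weight N x * (real N * \<Lambda> $ i * P $ i $ j * service (False, i, i) (cars x (False, i, i))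
        * (h (add_car (True, i, j) (remove_car (False, i, i) x)) - h x)))
    = (\<Sum>i\<in>UNIV. \<Sum>j\<in>UNIV. real N * \<Lambda> $ i * P $ i $ j * load N (False, i, i) * (H (True, i, j) - H (False, i, i)))"
    unfolding H_def sum_weight_move[symmetric]
    by (subst sum.swap, intro sum.cong refl, rule sum.swap)
  also have "(\<Sum>x\<in>?S. \<Sum>i\<in>UNIV. \<Sum>j\<in>UNIV. \<Sum>k\<in>UNIV. weight N x * (\<mu> $ i $ j * q $ j $ k * service (True, i, j) (cars x (True, i, j))
        * (h (add_car (False, j, k) (remove_car (True, i, j) x)) - h x)))
    = (\<Sum>i\<in>UNIV. \<Sum>j\<in>UNIV. \<Sum>k\<in>UNIV. \<mu> $ i $ j * q $ j $ k * load N (True, i, j) * (H (False, j, k) - H (True, i, j)))"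
    unfolding H_def sum_weight_move[symmetric]
    by (subst sum.swap, intro sum.cong refl, subst sum.swap, intro sum.cong refl, rule sum.swap)
  also have "(\<Sum>x\<in>?S. \<Sum>i\<in>UNIV. \<Sum>j\<in>UNIV - {i}. weight N x * (\<mu> $ i $ j * service (False, i, j) (cars x (False, i, j))
        * (h (add_car (False, j, j) (remove_car (False, i, j) x)) - h x)))
    = (\<Sum>i\<in>UNIV. \<Sum>j\<in>UNIV - {i}. \<mu> $ i $ j * load N (False, i, j) * (H (False, j, j) - H (False, i, j)))"
    unfolding H_def sum_weight_move[symmetric]
    by (subst sum.swap, intro sum.cong refl, rule sum.swap)
  also have "(\<Sum>i\<in>UNIV. \<Sum>j\<in>UNIV. real N * \<Lambda> $ i * P $ i $ j * load N (False, i, i) * (H (True, i, j) - H (False, i, i)))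
      = real N * (\<Sum>i\<in>UNIV. \<Sum>j\<in>UNIV. \<Lambda> $ i * P $ i $ j * a $ i * (H (True, i, j) - H (False, i, i)))"
    by (simp add: load_def sum_distrib_left mult.assoc)
  also have "(\<Sum>i\<in>UNIV. \<Sum>j\<in>UNIV. \<Sum>k\<in>UNIV. \<mu> $ i $ j * q $ j $ k * load N (True, i, j) * (H (False, j, k) - H (True, i, j)))
      = real N * (\<Sum>i\<in>UNIV. \<Sum>j\<in>UNIV. \<Sum>k\<in>UNIV. \<mu> $ i $ j * q $ j $ k * f $ i $ j * (H (False, j, k) - H (True, i, j)))"
    unfolding sum_distrib_left by (intro sum.cong refl) (simp add: load_def)
  also have "(\<Sum>i\<in>UNIV. \<Sum>j\<in>UNIV - {i}. \<mu> $ i $ j * load N (False, i, j) * (H (False, j, j) - H (False, i, j)))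
      = real N * (\<Sum>i\<in>UNIV. \<Sum>j\<in>UNIV - {i}. \<mu> $ i $ j * e $ i $ j * (H (False, j, j) - H (False, i, j)))"
    unfolding sum_distrib_left by (intro sum.cong refl) (auto simp: load_def)
  finally show "(\<Sum>x\<in>?S. weight N x * (\<Sum>y\<in>?S. car_rate N \<Lambda> \<mu> P q x y * (h y - h x))) = 0"
    using fluid_balance[of "\<lambda>i j. H (True, i, j)" "\<lambda>i j. H (False, i, j)"]
    by (simp flip: distrib_left)
qed

lemma car_rate_nonneg: "0 \<le> car_rate N \<Lambda> \<mu> P q x y"
  unfolding car_rate_eq
  using less_imp_le[OF \<Lambda>_pos] less_imp_le[OF \<mu>_pos] less_imp_le[OF P_pos] q_nonneg service_nonneg
  by (intro add_nonneg_nonneg sum_nonneg) (auto intro!: mult_nonneg_nonneg)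

end

section \<open>Concentration\<close>

context fluid_solution
begin

text \<open>\<open>N * rigid k\<close> is the exponential growth rate of the largest weight of station \<open>k\<close>: the terms
  \<open>(N m)^n / n!\<close> peak near \<open>exp (N m)\<close>, whereas the weights \<open>a\<^sub>i^n\<close> of a queue are at most 1.\<close>

definition rigid :: "'r station \<Rightarrow> real" where
  "rigid k = (if is_queue k then 0 else mean k)"

lemma queue_cases:
  assumes "is_queue k"
  obtains "load N k = 1" | "load N k < 1" "mean k = 0"
proof -
  obtain i where k: "k = (False, i, i)" using assms by (cases k) (auto simp: is_queue_def)
  show thesis
  proof (cases "a $ i = 1")
    case True
    then show thesis using that(1) by (simp add: load_def k)
  next
    case False
    then have "a $ i < 1" using a_range(2)[of i] by simp
    then show thesis using that(2) complementary[of i] by (simp add: load_def k)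
  qed
qed

lemma station_weight_le: "station_weight N k n \<le> exp (real N * rigid k)"
proof (cases "is_queue k")
  case True
  then have "load N k \<le> 1" by (rule queue_cases[where N = N]) auto
  then show ?thesis
    using True load_nonneg[of N k] by (simp add: station_weight_def rigid_def power_le_one)
next
  case False
  then show ?thesis
    using power_over_fact_le_exp[of "real N * mean k" n] mean_range(1)[of k]
    by (simp add: station_weight_def rigid_def load_def)
qed

lemma station_weight_ge:
  "exp (- (real N * (mean k - rigid k))) * ((real N * mean k) ^ n / fact n) \<le> station_weight N k n"
proof (cases "is_queue k")
  case True
  then show ?thesis
  proof (cases rule: queue_cases[where N = N, case_names critical stable])
    case critical
    have "(real N * mean k) ^ n / fact n \<le> exp (real N * mean k)"
      using mean_range(1)[of k] by (intro power_over_fact_le_exp) simp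
    then show ?thesis
      using True critical by (simp add: station_weight_def rigid_def exp_minus field_simps)
  next
    \<comment> \<open>Here \<open>mean k\<close> is 0, so the left side vanishes except at n = 0,
      where both sides are 1.\<close>
    case stable
    then show ?thesis
      using True load_nonneg[of N k] by (cases n) (auto simp: station_weight_def rigid_def)
  qed
next
  case False
  then show ?thesis by (simp add: station_weight_def rigid_def load_def)
qed

section \<open>Bounds on the normalising sum and on single weights\<close>

definition rigid_mass :: real where
  "rigid_mass = (\<Sum>k\<in>UNIV. rigid k)"

definition partition_sum :: "nat \<Rightarrow> real" where
  "partition_sum N = (\<Sum>x\<in>car_states N. weight N x)"

text \<open>\<open>1 - rigid_mass\<close> is the fluid mass waiting in queues, the price of trading
  their weights for Poisson terms. After the trade all stations are Poisson, with means adding up to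
  N.\<close>

lemma partition_sum_ge:
  "exp (- (real N * (1 - rigid_mass))) * (real N ^ N / fact N) \<le> partition_sum N"
proof -
  have "exp (- (real N * (1 - rigid_mass))) = (\<Prod>k\<in>UNIV. exp (- (real N * (mean k - rigid k))))"
    by (simp add: rigid_mass_def sum_mean sum_subtractf right_diff_distrib sum_negf
        flip: exp_sum sum_distrib_left)
  moreover have "(\<Sum>x\<in>car_states N. \<Prod>k\<in>UNIV. (real N * mean k) ^ cars x k / fact (cars x k)) = real N ^ N / fact N"
    by (rule sum_car_states_multinomial) (simp add: sum_mean flip: sum_distrib_left)
  ultimately have "exp (- (real N * (1 - rigid_mass))) * (real N ^ N / fact N)
      = (\<Sum>x\<in>car_states N. \<Prod>k\<in>UNIV. exp (- (real N * (mean k - rigid k))) *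
          ((real N * mean k) ^ cars x k / fact (cars x k)))"
    by (simp only: prod.distrib sum_distrib_left[symmetric])
  also have "\<dots> \<le> partition_sum N"
    unfolding partition_sum_def weight_def
    using mean_range(1) by (intro sum_mono prod_mono conjI station_weight_ge) auto
  finally show ?thesis .
qed

lemma partition_sum_pos:
  assumes "0 < N"
  shows "0 < partition_sum N"
  by (rule less_le_trans[OF _ partition_sum_ge]) (use assms in simp)

text \<open>The other factors are bounded by \<open>station_weight_le\<close>, so a saving
  \<open>t\<close> at one station reaches the whole weight, whatever the other stations do.\<close>

lemma weight_le:
  assumes "station_weight N l (cars x l) \<le> exp (real N * rigid l - t)"
  shows "weight N x \<le> exp (real N * rigid_mass - t)"
proof -
  have "weight N x = station_weight N l (cars x l) * (\<Prod>k\<in>UNIV - {l}. station_weight N k (cars x k))"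
    unfolding weight_def by (rule prod.remove) auto
  also have "\<dots> \<le> exp (real N * rigid l - t) * (\<Prod>k\<in>UNIV - {l}. exp (real N * rigid k))"
    using assms station_weight_nonneg station_weight_le
    by (intro mult_mono prod_mono prod_nonneg) auto
  also have "\<dots> = exp (real N * rigid l - t + (\<Sum>k\<in>UNIV - {l}. real N * rigid k))"
    by (simp add: exp_sum exp_add)
  also have "real N * rigid l - t + (\<Sum>k\<in>UNIV - {l}. real N * rigid k) = real N * rigid_mass - t"
    by (simp add: rigid_mass_def sum.remove[of UNIV l] sum_distrib_left distrib_left)
  finally show ?thesis .
qed

text \<open>The stations whose weights alone enforce a density. The complement consists of the
  queues with a_i = 1, whose weights are identically 1.\<close>

definition concentrated :: "'r station set" where
  "concentrated = {k. is_queue k \<longrightarrow> a $ fst (snd k) < 1}"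

lemma station_weight_deviation:
  assumes l: "l \<in> concentrated" and \<epsilon>: "0 < \<epsilon>"
  obtains c where "0 < c"
    and "\<And>N n. \<epsilon> * real N \<le> \<bar>real n - real N * mean l\<bar> \<Longrightarrow>
           station_weight N l n \<le> exp (real N * rigid l - real N * c)"
proof (cases "is_queue l")
  case True
  then obtain i where i: "l = (False, i, i)" by (cases l) (auto simp: is_queue_def)
  have a: "0 \<le> a $ i" "a $ i < 1" using l a_range(1)[of i] by (auto simp: concentrated_def i)
  then have "mean l = 0" using complementary[of i] by (simp add: i)
  moreover obtain c where c: "0 < c" "\<And>N n. \<epsilon> * real N \<le> real n \<Longrightarrow> (a $ i) ^ n \<le> exp (- (real N * c))"
    using geometric_deviation[OF a \<epsilon>] by metis
  ultimately show thesis
    using that[OF c(1)] by (simp add: station_weight_def load_def rigid_def i)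
next
  case False
  \<comment> \<open>\<open>poisson_deviation\<close> works for deviations of at most 1, and a
    deviation by \<epsilon> is also one by the smaller \<delta>.\<close>
  define \<delta> where "\<delta> = min \<epsilon> 1"
  have \<delta>: "0 < \<delta>" "\<delta> \<le> 1" "\<delta> \<le> \<epsilon>" using \<epsilon> by (auto simp: \<delta>_def)
  show thesis
  proof (rule that)
    show "0 < \<delta>\<^sup>2 / 4" using \<delta> by simp
    fix N n assume "\<epsilon> * real N \<le> \<bar>real n - real N * mean l\<bar>"
    then have "\<delta> * real N \<le> \<bar>real n - real N * mean l\<bar>"
      using mult_right_mono[OF \<delta>(3), of "real N"] by simp
    from poisson_deviation[OF mean_range[of l] \<delta>(1,2) this]
    show "station_weight N l n \<le> exp (real N * rigid l - real N * (\<delta>\<^sup>2 / 4))"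
      using False by (simp add: station_weight_def load_def rigid_def)
  qed
qed

end

section \<open>The stationary law and its concentration\<close>

locale stationary_network = fluid_solution \<Lambda> a \<mu> P q e f
  for \<Lambda> a :: "real ^ 'r::finite" and \<mu> P q e f :: "real ^ 'r ^ 'r" +
  fixes \<pi> :: "nat \<Rightarrow> 'r state pmf"
  assumes unique_class: "\<And>N. 0 < N \<Longrightarrow> \<exists>!C. recurrent_class (car_states N) (car_rate N \<Lambda> \<mu> P q) C"
    and stationary: "\<And>N. 0 < N \<Longrightarrow> stationary_distribution (car_states N) (car_rate N \<Lambda> \<mu> P q) (\<pi> N)"
begin

lemma set_pmf_subset: "0 < N \<Longrightarrow> set_pmf (\<pi> N) \<subseteq> car_states N"
  using stationary by (simp add: stationary_distribution_def)

lemma product_form: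
  assumes N: "0 < N" and x: "x \<in> car_states N"
  shows "pmf (\<pi> N) x = weight N x / partition_sum N"
proof -
  obtain M where M: "N = Suc M" using N gr0_implies_Suc by blast
  \<comment> \<open>Both measures are balanced and have mass 1, so their difference has mass 0 and
    falls under the uniqueness lemma.\<close>
  define d where "d y = pmf (\<pi> N) y - 1 / partition_sum N * weight N y" for y
  have "d x = 0"
  proof (rule balanced_sum_zero_imp_zero[OF finite_car_states _ _ _ unique_class[OF N] x])
    show "balanced (car_states N) (car_rate N \<Lambda> \<mu> P q) d"
      unfolding d_def using stationary[OF N] weight_balanced[of M N]
      by (intro balanced_diff stationary_distribution_balanced) (auto simp: M)
    have "(\<Sum>y\<in>car_states N. pmf (\<pi> N) y) = 1"
      using set_pmf_subset[OF N] by (intro sum_pmf_eq_1) auto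
    then show "(\<Sum>y\<in>car_states N. d y) = 0"
      using partition_sum_pos[OF N] by (simp add: d_def sum_subtractf partition_sum_def flip: sum_divide_distrib)
  qed (rule car_rate_nonneg)
  then show ?thesis by (simp add: d_def)
qed

lemma expectation_eq:
  assumes "0 < N"
  shows "measure_pmf.expectation (\<pi> N) h = (\<Sum>x\<in>car_states N. weight N x * h x) / partition_sum N"
  using assms set_pmf_subset[OF assms]
  by (subst integral_measure_pmf_real[of "car_states N"])
     (auto simp: product_form sum_divide_distrib mult.commute)

lemma deviation_tendsto_0:
  assumes l: "l \<in> concentrated" and \<epsilon>: "0 < \<epsilon>"
  shows "(\<lambda>N. measure_pmf.prob (\<pi> N) {x. \<epsilon> \<le> \<bar>real (cars x l) / real N - mean l\<bar>}) \<longlonglongrightarrow> 0"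
proof -
  obtain c where c: "0 < c"
    and dev: "\<And>N n. \<epsilon> * real N \<le> \<bar>real n - real N * mean l\<bar> \<Longrightarrow>
      station_weight N l n \<le> exp (real N * rigid l - real N * c)"
    using station_weight_deviation[OF l \<epsilon>] by metis
  define D where "D = CARD('r station)"
  \<comment> \<open>At most (N + 1)^D <= (2 N)^D states, a factor e N from Stirling, and the
    exponential decay at the single station \<open>l\<close>.\<close>
  define B where "B N = exp 1 * 2 ^ D * (real N ^ Suc D * exp (- (real N * c)))" for N
  have bound: "measure_pmf.prob (\<pi> N) {x. \<epsilon> \<le> \<bar>real (cars x l) / real N - mean l\<bar>} \<le> B N" if N: "0 < N" for N
  proof -
    let ?A = "{x. \<epsilon> \<le> \<bar>real (cars x l) / real N - mean l\<bar>}"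
    have summand: "weight N x * indicator ?A x \<le> exp (real N * rigid_mass - real N * c)" for x
    proof (cases "x \<in> ?A")
      case True
      then have "\<epsilon> * real N \<le> \<bar>real (cars x l) / real N - mean l\<bar> * \<bar>real N\<bar>"
        by (intro mult_mono) auto
      also have "\<dots> = \<bar>real (cars x l) - real N * mean l\<bar>"
        using N by (simp add: field_simps flip: abs_mult)
      finally show ?thesis using weight_le[OF dev] True by simp
    qed simp
    have "measure_pmf.prob (\<pi> N) ?A = measure_pmf.expectation (\<pi> N) (indicator ?A)"
      by simp
    also have "\<dots> = (\<Sum>x\<in>car_states N. weight N x * indicator ?A x) / partition_sum N"
      by (rule expectation_eq[OF N])
    also have "\<dots> \<le> (real (N + 1) ^ D * exp (real N * rigid_mass - real N * c)) / partition_sum N"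
    proof (intro divide_right_mono)
      have "(\<Sum>x\<in>car_states N. weight N x * indicator ?A x)
          \<le> real (card (car_states N :: 'r state set)) * exp (real N * rigid_mass - real N * c)"
        by (rule sum_bounded_above) (rule summand)
      also have "\<dots> \<le> real (N + 1) ^ D * exp (real N * rigid_mass - real N * c)"
      proof (rule mult_right_mono)
        have "real (card (car_states N :: 'r state set)) \<le> real ((N + 1) ^ D)"
          unfolding D_def of_nat_le_iff by (rule card_car_states)
        then show "real (card (car_states N :: 'r state set)) \<le> real (N + 1) ^ D" by simp
      qed simp
      finally show "(\<Sum>x\<in>car_states N. weight N x * indicator ?A x)
          \<le> real (N + 1) ^ D * exp (real N * rigid_mass - real N * c)" .
    qed (use partition_sum_pos[OF N] in simp)
    also have "\<dots> \<le> (real (N + 1) ^ D * exp (real N * rigid_mass - real N * c))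
        / (exp (- (real N * (1 - rigid_mass))) * (real N ^ N / fact N))"
      using N partition_sum_pos[OF N] by (intro divide_left_mono partition_sum_ge) auto
    \<comment> \<open>The growth \<open>exp (N * rigid_mass)\<close> of the weights cancels. Besides
      the decay there remains exp N * N! / N^N, which is of polynomial size.\<close>
    also have "\<dots> = real (N + 1) ^ D * exp (real N - real N * c) * (fact N / real N ^ N)"
    proof -
      have "exp (real N * rigid_mass - real N * c) = exp (real N - real N * c) * exp (- (real N * (1 - rigid_mass)))"
        by (simp add: algebra_simps flip: exp_add)
      then show ?thesis by simp
    qed
    also have "\<dots> \<le> real (N + 1) ^ D * exp (real N - real N * c) * (exp 1 * real N * exp (- real N))"
    proof (rule mult_left_mono)
      have "fact N / real N ^ N \<le> exp 1 * real N * (real N / exp 1) ^ N / real N ^ N"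
        by (intro divide_right_mono fact_le_Stirling N) simp
      also have "\<dots> = exp 1 * real N * exp (- real N)"
        using N by (simp add: power_divide exp_minus exp_of_nat_mult[of N 1, simplified] field_simps)
      finally show "fact N / real N ^ N \<le> exp 1 * real N * exp (- real N)" .
    qed simp
    also have "\<dots> = real (N + 1) ^ D * (exp 1 * real N * exp (- (real N * c)))"
      by (simp add: exp_diff exp_minus field_simps)
    also have "\<dots> \<le> (2 * real N) ^ D * (exp 1 * real N * exp (- (real N * c)))"
      using N by (intro mult_right_mono power_mono) auto
    finally show ?thesis by (simp add: B_def power_mult_distrib mult_ac)
  qed
  have "B \<longlonglongrightarrow> exp 1 * 2 ^ D * 0"
    unfolding B_def by (intro tendsto_mult tendsto_const power_mult_exp_tendsto_0 c)
  then have B0: "B \<longlonglongrightarrow> 0" by simp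
  have ev: "\<forall>\<^sub>F N in sequentially. measure_pmf.prob (\<pi> N) {x. \<epsilon> \<le> \<bar>real (cars x l) / real N - mean l\<bar>} \<le> B N"
    using eventually_gt_at_top[of 0] by eventually_elim (rule bound)
  show ?thesis
    by (rule tendsto_sandwich[OF _ ev tendsto_const B0]) simp
qed

text \<open>One random variable that dominates the error of every occupancy in the theorem, so that
  each of these limits reduces to an inequality between functions of the state.\<close>

definition deviation :: "nat \<Rightarrow> 'r state \<Rightarrow> real" where
  "deviation N x = (\<Sum>k\<in>concentrated. \<bar>real (cars x k) / real N - mean k\<bar>)"

lemma prob_deviation_tendsto_0:
  assumes \<epsilon>: "0 < \<epsilon>"
  shows "(\<lambda>N. measure_pmf.prob (\<pi> N) {x. \<epsilon> \<le> deviation N x}) \<longlonglongrightarrow> 0"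
proof -
  \<comment> \<open>The added 1 keeps a sum of deviations below \<delta> strictly smaller than
    \<epsilon>.\<close>
  define \<delta> where "\<delta> = \<epsilon> / (real (card concentrated) + 1)"
  have \<delta>: "0 < \<delta>" using \<epsilon> by (simp add: \<delta>_def add_nonneg_pos)
  define A where "A N k = {x. \<delta> \<le> \<bar>real (cars x k) / real N - mean k\<bar>}" for N k
  have sub: "{x. \<epsilon> \<le> deviation N x} \<subseteq> (\<Union>k\<in>concentrated. A N k)" for N
  proof (rule ccontr)
    assume "\<not> ?thesis"
    then obtain x where x: "\<epsilon> \<le> deviation N x" "\<And>k. k \<in> concentrated \<Longrightarrow> x \<notin> A N k" by auto
    have "deviation N x \<le> real (card concentrated) * \<delta>"
      unfolding deviation_def by (rule sum_bounded_above) (use x(2) in \<open>force simp: A_def\<close>)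
    also have "\<dots> < (real (card concentrated) + 1) * \<delta>" using \<delta> by simp
    also have "\<dots> = \<epsilon>" by (simp add: \<delta>_def)
    finally show False using x(1) by simp
  qed
  have bound: "measure_pmf.prob (\<pi> N) {x. \<epsilon> \<le> deviation N x}
      \<le> (\<Sum>k\<in>concentrated. measure_pmf.prob (\<pi> N) (A N k))" for N
    by (rule order_trans[OF measure_pmf.finite_measure_mono[OF sub]
          measure_pmf.finite_measure_subadditive_finite]) auto
  have "(\<lambda>N. \<Sum>k\<in>concentrated. measure_pmf.prob (\<pi> N) (A N k)) \<longlonglongrightarrow> (\<Sum>k\<in>concentrated. 0)"
    unfolding A_def by (intro tendsto_sum deviation_tendsto_0 \<delta>)
  then have "(\<lambda>N. \<Sum>k\<in>concentrated. measure_pmf.prob (\<pi> N) (A N k)) \<longlonglongrightarrow> 0" by simp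
  then show ?thesis
    by (rule tendsto_sandwich[OF _ always_eventually[OF allI[OF bound]] tendsto_const, rotated]) simp
qed

text \<open>The inequality is asked only of states with N cars, because the critical queues are
  controlled solely through the conserved total.\<close>

lemma converges_in_law_if_dist_le_deviation:
  fixes X :: "nat \<Rightarrow> 'r state \<Rightarrow> 'b::metric_space"
  assumes le: "\<And>N x. 0 < N \<Longrightarrow> x \<in> car_states N \<Longrightarrow> dist (X N x) c \<le> deviation N x"
  shows "converges_in_law_to_const \<pi> X c"
proof (rule converges_in_law_to_constI)
  fix \<epsilon> :: real assume \<epsilon>: "0 < \<epsilon>"
  have "measure_pmf.prob (\<pi> N) {x. \<epsilon> \<le> dist (X N x) c} \<le> measure_pmf.prob (\<pi> N) {x. \<epsilon> \<le> deviation N x}"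
    if N: "0 < N" for N
    by (rule measure_pmf.finite_measure_mono_AE)
       (use set_pmf_subset[OF N] le[OF N] in \<open>force simp: AE_measure_pmf_iff\<close>)+
  then have "\<forall>\<^sub>F N in sequentially. measure_pmf.prob (\<pi> N) {x. \<epsilon> \<le> dist (X N x) c}
      \<le> measure_pmf.prob (\<pi> N) {x. \<epsilon> \<le> deviation N x}"
    using eventually_gt_at_top[of 0] by (rule eventually_mono[rotated])
  then show "(\<lambda>N. measure_pmf.prob (\<pi> N) {x. \<epsilon> \<le> dist (X N x) c}) \<longlonglongrightarrow> 0"
    by (rule tendsto_sandwich[OF _ _ tendsto_const prob_deviation_tendsto_0[OF \<epsilon>], rotated]) simp
qed

lemma station_converges:
  assumes "k \<in> concentrated"
  shows "converges_in_law_to_const \<pi> (\<lambda>N x. real (cars x k) / real N) (mean k)"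
proof (rule converges_in_law_if_dist_le_deviation)
  show "dist (real (cars x k) / real N) (mean k) \<le> deviation N x" for N x
    unfolding deviation_def dist_real_def using assms by (rule member_le_sum) auto
qed

lemma full_cars_converge: "converges_in_law_to_const \<pi> (\<lambda>N (E, F). scaled N F) f"
proof (rule converges_in_law_if_dist_le_deviation)
  fix N and x :: "'r state"
  have vec: "norm v \<le> (\<Sum>i\<in>UNIV. \<Sum>j\<in>UNIV. \<bar>v $ i $ j\<bar>)" for v :: "real ^ 'r ^ 'r"
  proof -
    have "norm v \<le> (\<Sum>i\<in>UNIV. norm (v $ i))"
      unfolding norm_vec_def by (rule L2_set_le_sum) simp
    also have "\<dots> \<le> (\<Sum>i\<in>UNIV. \<Sum>j\<in>UNIV. \<bar>v $ i $ j\<bar>)"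
      by (intro sum_mono norm_le_l1_cart)
    finally show ?thesis .
  qed
  have "dist (case x of (E, F) \<Rightarrow> scaled N F) f = norm (scaled N (snd x) - f)"
    by (cases x) (simp add: dist_norm)
  also have "\<dots> \<le> (\<Sum>i\<in>UNIV. \<Sum>j\<in>UNIV. \<bar>(scaled N (snd x) - f) $ i $ j\<bar>)" by (rule vec)
  also have "\<dots> = (\<Sum>k\<in>range (Pair True). \<bar>real (cars x k) / real N - mean k\<bar>)"
    by (subst sum.reindex)
       (auto simp: inj_on_def scaled_def sum.cartesian_product cars_def intro!: sum.cong)
  also have "\<dots> \<le> deviation N x"
    unfolding deviation_def by (rule sum_mono2) (auto simp: concentrated_def is_queue_def)
  finally show "dist (case x of (E, F) \<Rightarrow> scaled N F) f \<le> deviation N x" .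
qed

text \<open>The scaled counts and the means both have total 1, so the errors of all stations add up
  to 0. The error of the critical sum is thus minus the total error of the concentrated
  stations.\<close>

lemma critical_queues_converge:
  "converges_in_law_to_const \<pi> (\<lambda>N (E, F). \<Sum>i | a $ i = 1. scaled N E $ i $ i) (\<Sum>i | a $ i = 1. e $ i $ i)"
proof (rule converges_in_law_if_dist_le_deviation)
  fix N and x :: "'r state" assume N: "0 < N" and x: "x \<in> car_states N"
  define g where "g k = real (cars x k) / real N - mean k" for k
  have compl: "- concentrated = (\<lambda>i. (False, i, i)) ` {i. a $ i = 1}"
    using a_range(2) by (fastforce simp: concentrated_def is_queue_def image_iff less_le)
  have "(\<Sum>k\<in>UNIV. real (cars x k)) = real N"
    using x unfolding car_states_iff by (metis of_nat_sum)
  then have "(\<Sum>k\<in>UNIV. g k) = 0"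
    using N by (simp add: g_def sum_subtractf sum_mean flip: sum_divide_distrib)
  moreover have "(\<Sum>k\<in>UNIV. g k) = (\<Sum>k\<in>concentrated. g k) + (\<Sum>k\<in>- concentrated. g k)"
    by (subst sum.union_disjoint[symmetric]) auto
  moreover have "(\<Sum>k\<in>- concentrated. g k) = (\<Sum>i | a $ i = 1. g (False, i, i))"
    unfolding compl by (subst sum.reindex) (auto simp: inj_on_def)
  ultimately have "(\<Sum>i | a $ i = 1. g (False, i, i)) = - (\<Sum>k\<in>concentrated. g k)" by simp
  moreover have "dist (case x of (E, F) \<Rightarrow> \<Sum>i | a $ i = 1. scaled N E $ i $ i) (\<Sum>i | a $ i = 1. e $ i $ i)
      = \<bar>\<Sum>i | a $ i = 1. g (False, i, i)\<bar>"
    by (cases x) (simp add: dist_real_def g_def scaled_def sum_subtractf)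
  ultimately show "dist (case x of (E, F) \<Rightarrow> \<Sum>i | a $ i = 1. scaled N E $ i $ i)
      (\<Sum>i | a $ i = 1. e $ i $ i) \<le> deviation N x"
    unfolding deviation_def by (simp add: g_def[symmetric] sum_abs)
qed

text \<open>Both sides equal \<open>\<Lambda> $ i * P $ i $ i * a $ i\<close> times the ratio of the partition sums over
  \<open>N - 1\<close> and \<open>N\<close> cars.\<close>

lemma throughput:
  assumes N: "0 < N"
  shows "\<Lambda> $ i * P $ i $ i * measure_pmf.prob (\<pi> N) {x. cars x (False, i, i) > 0}
    = \<mu> $ i $ i * measure_pmf.expectation (\<pi> N) (\<lambda>x. real (cars x (True, i, i)) / real N)"
proof -
  obtain M where M: "N = Suc M" using N gr0_implies_Suc by blast
  define R where "R = (\<Sum>z\<in>car_states M. weight N z) / partition_sum N"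
  have E: "measure_pmf.expectation (\<pi> N) (\<lambda>x. service k (cars x k)) = load N k * R" for k
    unfolding R_def using expectation_eq[OF N] sum_weight_service[where g = "\<lambda>_. 1"] by (simp add: M)
  have "measure_pmf.prob (\<pi> N) {x. cars x (False, i, i) > 0}
      = measure_pmf.expectation (\<pi> N) (indicator {x. cars x (False, i, i) > 0})" by simp
  also have "\<dots> = measure_pmf.expectation (\<pi> N) (\<lambda>x. service (False, i, i) (cars x (False, i, i)))"
    by (intro Bochner_Integration.integral_cong) (auto simp: service_def)
  also have "\<dots> = a $ i * R" using E[of "(False, i, i)"] by (simp add: load_def)
  finally have "\<Lambda> $ i * P $ i $ i * measure_pmf.prob (\<pi> N) {x. cars x (False, i, i) > 0}
      = \<mu> $ i $ i * (f $ i $ i * R)"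
    using full_balance[of i i] by (simp flip: mult.assoc)
  also have "f $ i $ i * R = measure_pmf.expectation (\<pi> N) (\<lambda>x. real (cars x (True, i, i)) / real N)"
    using E[of "(True, i, i)"] N by (simp add: load_def service_def)
  finally show ?thesis .
qed

section \<open>Limit of the probability that a queue is nonempty\<close>

lemma expectation_full_converges:
  "(\<lambda>N. measure_pmf.expectation (\<pi> N) (\<lambda>x. real (cars x (True, i, j)) / real N)) \<longlonglongrightarrow> f $ i $ j"
proof -
  \<comment> \<open>Convergence in law controls bounded continuous functions only. The identity is
    therefore clipped to [0, 1], which changes nothing on the support because no station holds more
    than N cars.\<close>
  define g :: "real \<Rightarrow> real" where "g t = max 0 (min 1 t)" for t
  have "continuous_on UNIV g" unfolding g_def by (intro continuous_intros)
  moreover have "bounded (range g)"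
    by (rule boundedI[of _ 1]) (auto simp: g_def)
  moreover have "converges_in_law_to_const \<pi> (\<lambda>N x. real (cars x (True, i, j)) / real N) (f $ i $ j)"
    using station_converges[of "(True, i, j)"] by (simp add: concentrated_def)
  ultimately have "(\<lambda>N. \<integral>t. g t \<partial>law (\<pi> N) (\<lambda>x. real (cars x (True, i, j)) / real N))
      \<longlonglongrightarrow> (\<integral>t. g t \<partial>return borel (f $ i $ j))"
    unfolding converges_in_law_to_const_def weakly_converges_def by blast
  moreover have meas: "g \<in> borel_measurable borel" unfolding g_def by measurable
  moreover have "(\<integral>t. g t \<partial>return borel (f $ i $ j)) = f $ i $ j"
    using meas f_range by (subst integral_return) (auto simp: g_def)
  moreover have "(\<integral>t. g t \<partial>law (\<pi> N) (\<lambda>x. real (cars x (True, i, j)) / real N))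
      = measure_pmf.expectation (\<pi> N) (\<lambda>x. real (cars x (True, i, j)) / real N)" if N: "0 < N" for N
  proof -
    have *: "g (real (cars x (True, i, j)) / real N) = real (cars x (True, i, j)) / real N"
      if "x \<in> set_pmf (\<pi> N)" for x
    proof -
      have "cars x (True, i, j) \<le> (\<Sum>k\<in>UNIV. cars x k)" by (rule member_le_sum) auto
      also have "\<dots> = N" using that set_pmf_subset[OF N] by (auto simp: car_states_iff)
      finally show ?thesis using N by (simp add: g_def)
    qed
    have "(\<integral>t. g t \<partial>law (\<pi> N) (\<lambda>x. real (cars x (True, i, j)) / real N))
        = measure_pmf.expectation (\<pi> N) (\<lambda>x. g (real (cars x (True, i, j)) / real N))"
      unfolding law_def using meas by (subst integral_distr) simp_all
    also have "\<dots> = measure_pmf.expectation (\<pi> N) (\<lambda>x. real (cars x (True, i, j)) / real N)"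
      by (rule integral_cong_AE) (simp_all add: AE_measure_pmf_iff *)
    finally show ?thesis .
  qed
  ultimately show ?thesis
    by (auto elim!: Lim_transform_eventually intro!: eventually_mono[OF eventually_gt_at_top[of 0]])
qed

text \<open>The weak limit of E_ii / N does not decide whether the queue is empty. The probability
  is read off from the flow out of the queue instead, by dividing \<open>throughput\<close> by
  \<lambda>_i P_ii, which is positive.\<close>

lemma availability_converges:
  "(\<lambda>N. measure_pmf.prob (\<pi> N) {x. cars x (False, i, i) > 0}) \<longlonglongrightarrow> a $ i"
proof -
  define r where "r = \<mu> $ i $ i / (\<Lambda> $ i * P $ i $ i)"
  have pos: "0 < \<Lambda> $ i * P $ i $ i" using \<Lambda>_pos P_pos by simp
  have "(\<lambda>N. r * measure_pmf.expectation (\<pi> N) (\<lambda>x. real (cars x (True, i, i)) / real N)) \<longlonglongrightarrow> r * f $ i $ i"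
    by (intro tendsto_mult tendsto_const expectation_full_converges)
  moreover have "r * f $ i $ i = (\<Lambda> $ i * P $ i $ i * a $ i) / (\<Lambda> $ i * P $ i $ i)"
    by (simp add: r_def full_balance)
  then have "r * f $ i $ i = a $ i"
    using \<Lambda>_pos[of i] P_pos[of i i] by simp
  moreover have "\<forall>\<^sub>F N in sequentially.
      r * measure_pmf.expectation (\<pi> N) (\<lambda>x. real (cars x (True, i, i)) / real N)
      = measure_pmf.prob (\<pi> N) {x. cars x (False, i, i) > 0}"
    using eventually_gt_at_top[of 0]
  proof eventually_elim
    case (elim N)
    then show ?case using throughput[OF elim, of i] pos \<Lambda>_pos[of i] P_pos[of i i] by (simp add: r_def field_simps)
  qed
  ultimately show ?thesis by (simp add: Lim_transform_eventually)
qed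

end

theorem theorem1:
  fixes \<Lambda> a :: "real ^ 'r"
    and \<mu> P q e f :: "real ^ 'r ^ 'r"
    and \<pi> :: "nat \<Rightarrow> 'r state pmf"
  assumes "\<And>i. 0 < \<Lambda> $ i"
    and "\<And>i j. 0 < \<mu> $ i $ j"
    and "row_stochastic P"
    and "fluid_feasible \<Lambda> \<mu> P q e f a"
    and "\<And>i j. 0 < P $ i $ j"
    and "\<And>i. 0 < q $ i $ i"
    and "\<And>N. 0 < N \<Longrightarrow> \<exists>!C. recurrent_class (car_states N) (car_rate N \<Lambda> \<mu> P q) C"
    and "\<And>N. 0 < N \<Longrightarrow> stationary_distribution (car_states N) (car_rate N \<Lambda> \<mu> P q) (\<pi> N)"
  shows "converges_in_law_to_const \<pi> (\<lambda>N (E, F). scaled N F) f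
    \<and> (\<forall>i j. i \<noteq> j \<longrightarrow>
          converges_in_law_to_const \<pi> (\<lambda>N (E, F). scaled N E $ i $ j) (e $ i $ j))
    \<and> (\<forall>i. a $ i < 1 \<longrightarrow>
          converges_in_law_to_const \<pi> (\<lambda>N (E, F). scaled N E $ i $ i) 0)
    \<and> converges_in_law_to_const \<pi>
          (\<lambda>N (E, F). \<Sum>i | a $ i = 1. scaled N E $ i $ i) (\<Sum>i | a $ i = 1. e $ i $ i)
    \<and> (\<forall>i. (\<lambda>N. measure_pmf.prob (\<pi> N) {(E, F). E $ i $ i > 0}) \<longlonglongrightarrow> a $ i)"
proof -
  interpret stationary_network \<Lambda> a \<mu> P q e f \<pi>
    by unfold_locales (fact assms)+
  have empty: "(\<lambda>N (E, F). scaled N E $ i $ j) = (\<lambda>N x. real (cars x (False, i, j)) / real N)" for i j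
    by (auto simp: fun_eq_iff scaled_def)
  have queue: "{(E, F). E $ i $ i > 0} = {x. cars x (False, i, i) > 0}" for i
    by auto
  show ?thesis
    unfolding empty queue
  proof (intro conjI allI impI)
    fix i j :: 'r assume "i \<noteq> j"
    then show "converges_in_law_to_const \<pi> (\<lambda>N x. real (cars x (False, i, j)) / real N) (e $ i $ j)"
      using station_converges[of "(False, i, j)"] by (simp add: concentrated_def)
  next
    fix i assume "a $ i < 1"
    then show "converges_in_law_to_const \<pi> (\<lambda>N x. real (cars x (False, i, i)) / real N) 0"
      \<comment> \<open>The limit obtained for the station is e_ii, and complementary slackness
        makes it 0.\<close>
      using station_converges[of "(False, i, i)"] complementary[of i] by (simp add: concentrated_def)
  qed (fact full_cars_converge critical_queues_converge availability_converges)+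
qed

end
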